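(* Let $A\ge 2$ and consider a competing growth process $(v_a(\tau_n))_{a\in[A],n\in\mathbb{N}_0}$ with initial values $(m_a)_{a\in[A]}\in\mathbb{N}_0^A$ and waiting times $(X^{(a)}_j)_{a\in[A],j\in\mathbb{N}}$, as defined in the context. Let $(X_j)_{j\in\mathbb{N}}$ and $(X'_j)_{j\in\mathbb{N}}$ be two independent sequences, each with the same law as $(X^{(1)}_j)_{j\in\mathbb{N}}$. Then: 1. Leadership occurs with probability zero or one. Moreover, leadership occurs with probability one if and only if the random series $\sum_{j=1}^{\infty}(X_j-X'_j)$ converges almost surely. 2. If $\sum_{j=1}^\infty X_j$ diverges almost surely, then monopoly occurs with probability zero. On the other hand, if $\sum_{j=1}^\infty X_j$ converges almost surely, and either (a) for any $a\neq a'$ in $[A]$ there exists $j>\min(m_a,m_{a'})$ such that the distribution of $X_j$ has no atom on $[0,\infty)$, or (b) for any sequence $(c_j)_{j\in\mathbb{N}}\in[0,\infty)^{\mathbb{N}}$ we have $\sum_{j=1}^\infty \mathbb{P}(X_j\neq c_j)=\infty$, then monopoly occurs with probability one. 3. If the series $\sum_{j=1}^\infty (X_j-X'_j)$ converges almost surely and, for any $a\neq a'$ in $[A]$, $$\sum_{k=1}^\infty \mathbb{P}\Big(0\le \sum_{j=m_{a'}+1}^{k} X'_j-\sum_{j=m_a+1}^{k}X_j < X_{k+1}\Big)<\infty,$$ then strict leadership occurs with probability one.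
   Context: Notation: $[A]=\{1,\dots,A\}$, $\mathbb{N}=\{1,2,\dots\}$, $\mathbb{N}_0=\mathbb{N}\cup\{0\}$; empty sums are $0$. Competing growth process. Let $A\ge2$ be the number of agents. To each agent $a\in[A]$ is associated a sequence $(X^{(a)}_j)_{j\in\mathbb{N}}$ of $[0,\infty)$-valued random variables. All the variables $X^{(a)}_j$ ($a\in[A]$, $j\in\mathbb{N}$) are mutually independent, and the sequences $(X^{(a)}_j)_{j\in\mathbb{N}}$ have the same law for all $a$ (for fixed $a$, the law of $X^{(a)}_j$ may depend on $j$). Agent $a$ has a deterministic initial value $m_a\in\mathbb{N}_0$, and $X^{(a)}_k$ is the time taken for the value of $a$ to increase from $k-1$ to $k$. That is, the value $v_a(t)$ of $a$ at time $t\ge0$ satisfies, for $k\in\mathbb{N}_0$, $$v_a(t)=m_a+k \iff \sum_{j=m_a+1}^{m_a+k}X^{(a)}_j\le t<\sum_{j=m_a+1}^{m_a+k+1}X^{(a)}_j,$$ and $v_a(t)=\infty$ if $t\ge\sum_{j=m_a+1}^\infty X^{(a)}_j$. Set $\tau_0:=0$ and, for $n\in\mathbb{N}$, $\tau_n:=\inf\{t\ge0:\sum_{a=1}^A v_a(t)\ge n\}$. The competing growth process is $(v_a(\tau_n))_{a\in[A],n\in\mathbb{N}_0}$. It is a standing assumption that this process is $\mathbb{N}_0$-valued, i.e. almost surely $v_a(\tau_n)<\infty$ for all $a\in[A]$, $n\in\mathbb{N}_0$ (explosion, $\lim_n\tau_n<\infty$, is allowed). Events. Leadership: there is $a\in[A]$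 such that $v_a(\tau_n)=\max_{a'\in[A]}v_{a'}(\tau_n)$ for all but finitely many $n$. Strict leadership: there is $a\in[A]$ such that, for all but finitely many $n$, $v_a(\tau_n)>v_{a'}(\tau_n)$ for every $a'\ne a$. Monopoly: there is a unique $a\in[A]$ such that $\lim_{n\to\infty}v_a(\tau_n)=\infty$. A series converges if its partial sums converge to a finite real limit, and diverges otherwise; by the Kolmogorov 0-1 law, a series of independent random variables converges almost surely or diverges almost surely. *)

theory Defs
  imports "HOL-Probability.Probability"
begin

text \<open>
  Agents are the numbers in \<open>{1..A}\<close>. A realisation of all waiting times is a function
  \<open>x :: nat \<Rightarrow> nat \<Rightarrow> real\<close>, where \<open>x a j\<close> with \<open>j \<ge> 1\<close> is the time agent \<open>a\<close> needs to
  get from value \<open>j - 1\<close> to value \<open>j\<close>; entries with \<open>j = 0\<close> are never used.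
\<close>

text \<open>
  For nonnegative waiting times and \<open>t \<ge> 0\<close> there is at most one \<open>k\<close> as below, and there is
  none exactly if \<open>t\<close> is at least the total of all waiting times after the initial value.
\<close>

definition agent_value :: "(nat \<Rightarrow> real) \<Rightarrow> nat \<Rightarrow> real \<Rightarrow> enat" where
  "agent_value x m t =
     (let at_step = (\<lambda>k. (\<Sum>j=m+1..m+k. x j) \<le> t \<and> t < (\<Sum>j=m+1..m+k+1. x j))
      in if \<exists>k. at_step k then enat (m + (THE k. at_step k)) else \<infinity>)"

definition tau :: "nat \<Rightarrow> (nat \<Rightarrow> nat) \<Rightarrow> (nat \<Rightarrow> nat \<Rightarrow> real) \<Rightarrow> nat \<Rightarrow> real" where
  "tau A m x n =
     (if n = 0 then 0
      else Inf {t. 0 \<le> t \<and> (\<Sum>a\<in>{1..A}. agent_value (x a) (m a) t) \<ge> enat n})"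

definition growth :: "nat \<Rightarrow> (nat \<Rightarrow> nat) \<Rightarrow> (nat \<Rightarrow> nat \<Rightarrow> real) \<Rightarrow> nat \<Rightarrow> nat \<Rightarrow> enat" where
  "growth A m x a n = agent_value (x a) (m a) (tau A m x n)"

definition leadership :: "nat \<Rightarrow> (nat \<Rightarrow> nat) \<Rightarrow> (nat \<Rightarrow> nat \<Rightarrow> real) \<Rightarrow> bool" where
  "leadership A m x \<longleftrightarrow>
     (\<exists>a\<in>{1..A}. eventually
        (\<lambda>n. growth A m x a n = Max ((\<lambda>a'. growth A m x a' n) ` {1..A})) sequentially)"

definition strict_leadership :: "nat \<Rightarrow> (nat \<Rightarrow> nat) \<Rightarrow> (nat \<Rightarrow> nat \<Rightarrow> real) \<Rightarrow> bool" where
  "strict_leadership A m x \<longleftrightarrow>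
     (\<exists>a\<in>{1..A}. eventually
        (\<lambda>n. \<forall>a'\<in>{1..A}. a' \<noteq> a \<longrightarrow> growth A m x a n > growth A m x a' n) sequentially)"

definition monopoly :: "nat \<Rightarrow> (nat \<Rightarrow> nat) \<Rightarrow> (nat \<Rightarrow> nat \<Rightarrow> real) \<Rightarrow> bool" where
  "monopoly A m x \<longleftrightarrow> (\<exists>!a. a \<in> {1..A} \<and> growth A m x a \<longlonglongrightarrow> \<infinity>)"

abbreviation seq_space :: "(nat \<Rightarrow> real) measure" where
  "seq_space \<equiv> Pi\<^sub>M {1..} (\<lambda>_. borel)"

definition seq_rv :: "(nat \<Rightarrow> 'w \<Rightarrow> real) \<Rightarrow> 'w \<Rightarrow> nat \<Rightarrow> real" where
  "seq_rv Y \<omega> = (\<lambda>j\<in>{1..}. Y j \<omega>)"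

locale competing_growth_process = prob_space M
  for M :: "'w measure" +
  fixes A :: nat
    and m :: "nat \<Rightarrow> nat"
    and X :: "nat \<Rightarrow> nat \<Rightarrow> 'w \<Rightarrow> real"
  assumes two_agents: "A \<ge> 2"
    and nonneg: "\<And>a j \<omega>. a \<in> {1..A} \<Longrightarrow> j \<ge> 1 \<Longrightarrow> \<omega> \<in> space M \<Longrightarrow> 0 \<le> X a j \<omega>"
    and indep: "indep_vars (\<lambda>_. borel) (\<lambda>(a, j). X a j) ({1..A} \<times> {1..})"
    and same_law: "\<And>a. a \<in> {1..A} \<Longrightarrow>
      distr M seq_space (seq_rv (X a)) = distr M seq_space (seq_rv (X 1))"
    and finite_valued:
      "AE \<omega> in M. \<forall>a\<in>{1..A}. \<forall>n. growth A m (\<lambda>a j. X a j \<omega>) a n < \<infinity>"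

text \<open>
  The measurability conjunct is needed because \<open>measure\<close> is \<open>0\<close> on non-measurable sets.
\<close>

definition occurs_with_prob :: "'w measure \<Rightarrow> ('w \<Rightarrow> bool) \<Rightarrow> real \<Rightarrow> bool" where
  "occurs_with_prob M P p \<longleftrightarrow>
     {\<omega> \<in> space M. P \<omega>} \<in> sets M \<and> measure M {\<omega> \<in> space M. P \<omega>} = p"

end

theory Submission
  imports Defs
begin

text \<open>
  Let \<open>reach a k\<close> be the time at which agent \<open>a\<close> has value \<open>k\<close>; then \<open>a\<close> has value at least \<open>k\<close>
  at the time \<open>tau n\<close> iff \<open>reach a k \<le> tau n\<close>. Everything is read off from the differences
  \<open>reach b k - reach a k\<close>, which are partial sums of independent random variables, symmetric
  beyond the initial values. If such a symmetric series converges, then its sum is almost surely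
  nonzero unless its terms eventually vanish, so any two agents are eventually ordered and the
  first agent in this order leads. If it diverges, then its partial sums are almost surely
  unbounded below, because partial sums bounded below would be bounded by symmetry and the 0-1 law,
  and a stopped second moment computation shows that bounded partial sums converge. Hence no agent
  can stay ahead of another one. Monopoly means that the agent with the least total waiting time
  is unique; ties are excluded either by an independent atomless summand, or again by the statement
  on symmetric series with sum zero.
\<close>

section \<open>Deterministic waiting times\<close>

text \<open>The process is observed only at the times \<open>tau n\<close>, and these may accumulate
  at a finite explosion time; an order of arrival after that time leaves no trace. That a leader is
  the first to reach every late level is therefore proved only for unbounded arrival times, and
  divergence of the difference series is what supplies them. A second obstacle is that waiting times
  may be zero, so that values are skipped and arrival times might attain their limit. Here the
  standing assumption enters: an agent tending to infinity whose waiting times eventually vanish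
  would have value \<open>\<infinity>\<close> at some \<open>tau n\<close>. The 0-1 law and the
  equality of the laws extend this from one agent to all. On the probabilistic side neither moments
  nor regularity of the laws are available. Moments come from truncating at a level that contains
  all increments on an event of positive probability, and symmetry keeps the truncated variables
  centred. A zero sum is excluded by comparing the measures of sets obtained from each other by one
  sign flip.\<close>

definition reach :: "(nat \<Rightarrow> real) \<Rightarrow> nat \<Rightarrow> nat \<Rightarrow> real" where
  "reach x m k = (\<Sum>j=m+1..k. x j)"

lemma reach_mono:
  assumes "\<And>j. j \<ge> 1 \<Longrightarrow> 0 \<le> x j" "k \<le> l"
  shows "reach x m k \<le> reach x m l"
  unfolding reach_def using assms by (intro sum_mono2) auto

lemma reach_nonneg:
  assumes "\<And>j. j \<ge> 1 \<Longrightarrow> 0 \<le> x j"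
  shows "0 \<le> reach x m k"
  unfolding reach_def using assms by (intro sum_nonneg) auto

text \<open>A zero waiting time makes an agent pass several values at once, but monotone partial
  sums still allow only one step at time \<open>t\<close>. If there is no step, induction keeps
  every partial sum at or below \<open>t\<close>, in accordance with the value
  \<open>\<infinity>\<close>. For \<open>k \<le> m\<close> the sum is empty and both sides
  hold.\<close>

lemma enat_le_agent_value_iff:
  assumes nonneg: "\<And>j. j \<ge> 1 \<Longrightarrow> 0 \<le> x j" and t: "0 \<le> t"
  shows "enat k \<le> agent_value x m t \<longleftrightarrow> reach x m k \<le> t"
proof -
  define at_step where "at_step l \<longleftrightarrow> reach x m (m + l) \<le> t \<and> t < reach x m (m + l + 1)" for l
  have mono: "reach x m k \<le> reach x m l" if "k \<le> l" for k l
    using reach_mono[OF nonneg that] by simp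
  have av: "agent_value x m t = (if \<exists>l. at_step l then enat (m + (THE l. at_step l)) else \<infinity>)"
    unfolding agent_value_def at_step_def reach_def Let_def by simp
  show ?thesis
  proof (cases "\<exists>l. at_step l")
    case True
    then obtain l where l: "at_step l" by blast
    have "l' = l" if "at_step l'" for l'
    proof (rule ccontr)
      assume "l' \<noteq> l"
      then consider "l' + 1 \<le> l" | "l + 1 \<le> l'" by linarith
      then show False
        using that l mono[of "m + l' + 1" "m + l"] mono[of "m + l + 1" "m + l'"]
        unfolding at_step_def by cases auto
    qed
    then have "(THE l. at_step l) = l" using l by (intro the_equality) blast+
    then have "agent_value x m t = enat (m + l)" using True av by simp
    moreover have "reach x m k \<le> t \<longleftrightarrow> k \<le> m + l"
      using l mono[of k "m + l"] mono[of "m + l + 1" k] unfolding at_step_def by force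
    ultimately show ?thesis by simp
  next
    case False
    have "reach x m (m + l) \<le> t" for l
    proof (induction l)
      case 0
      then show ?case using t by (simp add: reach_def)
    next
      case (Suc l)
      then show ?case using False unfolding at_step_def by force
    qed
    from this[of k] have "reach x m k \<le> t" using mono[of k "m + k"] by simp
    then show ?thesis using False av by simp
  qed
qed

section \<open>The times \<open>tau n\<close> as finite minima of arrival times\<close>

lemma Inf_UN_atLeast:
  fixes f :: "'a \<Rightarrow> real"
  assumes "finite K" "K \<noteq> {}"
  shows "Inf {t. \<exists>k\<in>K. f k \<le> t} = Min (f ` K)"
proof (rule cInf_eq_minimum)
  have "Min (f ` K) \<in> f ` K" using assms by (intro Min_in) auto
  then show "Min (f ` K) \<in> {t. \<exists>k\<in>K. f k \<le> t}" by auto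
  show "Min (f ` K) \<le> t" if t: "t \<in> {t. \<exists>k\<in>K. f k \<le> t}" for t
  proof -
    obtain k where "k \<in> K" "f k \<le> t" using t by blast
    then have "Min (f ` K) \<le> f k" using assms by (intro Min_le) auto
    then show ?thesis using \<open>f k \<le> t\<close> by simp
  qed
qed

text \<open>Vectors of target values with total at least \<open>n\<close>. Capping the entries at
  \<open>n\<close> makes the set finite and loses nothing, since one entry equal to \<open>n\<close>
  already suffices.\<close>

definition profiles :: "nat \<Rightarrow> nat \<Rightarrow> (nat \<Rightarrow> nat) set" where
  "profiles A n = {k \<in> {1..A} \<rightarrow>\<^sub>E {..n}. n \<le> sum k {1..A}}"

lemma finite_profiles: "finite (profiles A n)"
  unfolding profiles_def by (rule finite_subset[OF _ finite_PiE[of "{1..A}" "\<lambda>_. {..n}"]]) auto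

lemma profiles_nonempty:
  assumes "1 \<le> A" shows "profiles A n \<noteq> {}"
proof -
  have "n * 1 \<le> n * A" using assms by (intro mult_left_mono) auto
  then have "(\<lambda>a\<in>{1..A}. n) \<in> profiles A n"
    unfolding profiles_def by (auto simp: mult.commute)
  then show ?thesis by blast
qed

text \<open>The profile is \<open>v\<close> truncated at \<open>n\<close>: either some entry reaches
  \<open>n\<close> and suffices alone, or the truncation changes nothing. In both cases possible
  infinite values of \<open>v\<close> are out of the way.\<close>

lemma enat_le_sum_iff_profiles:
  fixes v :: "nat \<Rightarrow> enat"
  shows "enat n \<le> sum v {1..A} \<longleftrightarrow> (\<exists>k\<in>profiles A n. \<forall>a\<in>{1..A}. enat (k a) \<le> v a)"
proof
  assume n: "enat n \<le> sum v {1..A}"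
  define k where "k = (\<lambda>a\<in>{1..A}. the_enat (min (enat n) (v a)))"
  have k: "enat (k a) = min (enat n) (v a)" if "a \<in> {1..A}" for a
    using that unfolding k_def by (cases "v a") (auto simp: min_def)
  have "n \<le> sum k {1..A}"
  proof (cases "\<exists>a\<in>{1..A}. enat n \<le> v a")
    case True
    then obtain a where a: "a \<in> {1..A}" "enat n \<le> v a" by blast
    then have "k a = n" using k[of a] by (simp add: min_def)
    then show ?thesis using member_le_sum[of a "{1..A}" k] a by simp
  next
    case False
    then have "enat (k a) = v a" if "a \<in> {1..A}" for a
      using k[OF that] that by (metis linorder_not_less min.absorb4)
    then have "sum v {1..A} = (\<Sum>a\<in>{1..A}. enat (k a))" by simp
    also have "\<dots> = enat (sum k {1..A})"
      using of_nat_sum[of k "{1..A}", where 'a = enat] by (simp add: of_nat_eq_enat)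
    finally show ?thesis using n by simp
  qed
  moreover have "k a \<le> n" if "a \<in> {1..A}" for a
    using k[OF that] by (metis enat_ord_simps(1) min.cobounded1)
  ultimately have "k \<in> profiles A n"
    unfolding profiles_def by (auto simp: k_def)
  then show "\<exists>k\<in>profiles A n. \<forall>a\<in>{1..A}. enat (k a) \<le> v a"
    using k by (intro bexI[of _ k]) auto
next
  assume "\<exists>k\<in>profiles A n. \<forall>a\<in>{1..A}. enat (k a) \<le> v a"
  then obtain k where k: "k \<in> profiles A n" "\<forall>a\<in>{1..A}. enat (k a) \<le> v a" by blast
  have "enat n \<le> enat (sum k {1..A})" using k unfolding profiles_def by simp
  also have "\<dots> = (\<Sum>a\<in>{1..A}. enat (k a))"
    using of_nat_sum[of k "{1..A}", where 'a = enat] by (simp add: of_nat_eq_enat)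
  also have "\<dots> \<le> sum v {1..A}" using k by (intro sum_mono) auto
  finally show "enat n \<le> sum v {1..A}" .
qed

lemma enat_le_iff: "x \<le> y \<longleftrightarrow> (\<forall>k. enat k \<le> x \<longrightarrow> enat k \<le> y)" for x y :: enat
proof
  assume *: "\<forall>k. enat k \<le> x \<longrightarrow> enat k \<le> y"
  show "x \<le> y"
  proof (rule ccontr)
    assume "\<not> x \<le> y"
    then obtain l where "y = enat l" by (cases y) auto
    then have "enat (Suc l) \<le> x" using \<open>\<not> x \<le> y\<close> by (simp add: Suc_ile_eq)
    then show False using * \<open>y = enat l\<close> by auto
  qed
qed (auto intro: order_trans)

section \<open>Order of arrival and the discrete process\<close>

locale waiting_times =
  fixes A :: nat and m :: "nat \<Rightarrow> nat" and x :: "nat \<Rightarrow> nat \<Rightarrow> real"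
  assumes agents: "2 \<le> A"
    and x_nonneg: "\<And>a j. a \<in> {1..A} \<Longrightarrow> j \<ge> 1 \<Longrightarrow> 0 \<le> x a j"
begin

abbreviation rch :: "nat \<Rightarrow> nat \<Rightarrow> real" where
  "rch a k \<equiv> reach (x a) (m a) k"

abbreviation total :: "real \<Rightarrow> enat" where
  "total t \<equiv> (\<Sum>a\<in>{1..A}. agent_value (x a) (m a) t)"

lemma rch_mono: "a \<in> {1..A} \<Longrightarrow> k \<le> l \<Longrightarrow> rch a k \<le> rch a l"
  by (intro reach_mono x_nonneg)

lemma rch_nonneg: "a \<in> {1..A} \<Longrightarrow> 0 \<le> rch a k"
  by (intro reach_nonneg x_nonneg)

lemma le_value_iff:
  "a \<in> {1..A} \<Longrightarrow> 0 \<le> t \<Longrightarrow> enat k \<le> agent_value (x a) (m a) t \<longleftrightarrow> rch a k \<le> t"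
  by (intro enat_le_agent_value_iff x_nonneg)

lemma le_total_iff:
  assumes "0 \<le> t"
  shows "enat n \<le> total t \<longleftrightarrow>
    (\<exists>k\<in>profiles A n. Max ((\<lambda>a. rch a (k a)) ` {1..A}) \<le> t)"
proof -
  have "{1..A} \<noteq> {}" using agents by simp
  then show ?thesis
    using assms by (simp add: enat_le_sum_iff_profiles le_value_iff del: One_nat_def)
qed

text \<open>The total is at least \<open>n\<close> at time \<open>t\<close> iff some profile is
  completed by \<open>t\<close>, so the infimum is over a finite union of half-lines and is
  attained. For \<open>n = 0\<close> the only profile is zero and is completed at time 0. This form
  also makes \<open>tau\<close> measurable in the waiting times.\<close>

lemma tau_eq_Min:
  "tau A m x n = Min ((\<lambda>k. Max ((\<lambda>a. rch a (k a)) ` {1..A})) ` profiles A n)"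
proof -
  define f where "f k = Max ((\<lambda>a. rch a (k a)) ` {1..A})" for k
  have f: "0 \<le> f k" for k
  proof -
    have "0 \<le> rch 1 (k 1)" using agents by (intro rch_nonneg) auto
    also have "\<dots> \<le> f k" unfolding f_def using agents by (intro Max_ge) auto
    finally show ?thesis .
  qed
  have ne: "profiles A n \<noteq> {}" using agents by (intro profiles_nonempty) simp
  show ?thesis
  proof (cases "n = 0")
    case True
    then have "profiles A n = {\<lambda>a\<in>{1..A}. 0}" unfolding profiles_def by (auto simp: PiE_def extensional_def restrict_def)
    moreover have "f (\<lambda>a\<in>{1..A}. 0) = 0"
    proof -
      have "(\<lambda>a. rch a ((\<lambda>a\<in>{1..A}. 0) a)) ` {1..A} = {0}"
        using agents by (auto simp: reach_def intro!: image_eqI[of _ _ 1])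
      then show ?thesis unfolding f_def by simp
    qed
    ultimately show ?thesis
      using True unfolding tau_def f_def[symmetric] by (simp del: restrict_apply)
  next
    case False
    have "{t. 0 \<le> t \<and> enat n \<le> total t} = {t. \<exists>k\<in>profiles A n. f k \<le> t}"
      using le_total_iff[of _ n] order_trans[OF f] unfolding f_def[symmetric] by blast
    then show ?thesis
      using False Inf_UN_atLeast[OF finite_profiles ne, of f] unfolding tau_def f_def[symmetric]
      by simp
  qed
qed

text \<open>A Galois connection between \<open>tau\<close> and \<open>total\<close>; it holds with
  \<open>\<le>\<close> because the minimum is attained.\<close>

lemma tau_le_iff:
  assumes "0 \<le> t" shows "tau A m x n \<le> t \<longleftrightarrow> enat n \<le> total t"
proof -
  have "profiles A n \<noteq> {}" using agents by (intro profiles_nonempty) simp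
  then show ?thesis
    unfolding tau_eq_Min le_total_iff[OF assms] by (subst Min_le_iff) (auto simp: finite_profiles)
qed

lemma tau_nonneg: "0 \<le> tau A m x n"
proof (rule ccontr)
  assume "\<not> 0 \<le> tau A m x n"
  have "profiles A n \<noteq> {}" using agents by (intro profiles_nonempty) simp
  then have "tau A m x n \<in> (\<lambda>k. Max ((\<lambda>a. rch a (k a)) ` {1..A})) ` profiles A n"
    unfolding tau_eq_Min by (intro Min_in) (auto simp: finite_profiles)
  then obtain k where "tau A m x n = Max ((\<lambda>a. rch a (k a)) ` {1..A})" by auto
  moreover have "rch 1 (k 1) \<le> Max ((\<lambda>a. rch a (k a)) ` {1..A})" using agents by (intro Max_ge) auto
  moreover have "0 \<le> rch 1 (k 1)" using agents by (intro rch_nonneg) auto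
  ultimately show False using \<open>\<not> 0 \<le> tau A m x n\<close> by simp
qed

lemma le_total_tau: "enat n \<le> total (tau A m x n)"
  using tau_le_iff[OF tau_nonneg, of n n] by simp

lemma tau_mono: "n \<le> n' \<Longrightarrow> tau A m x n \<le> tau A m x n'"
  using tau_le_iff[OF tau_nonneg, of n n'] le_total_tau[of n'] by (metis enat_ord_simps(1) order_trans)

lemma le_growth_iff: "a \<in> {1..A} \<Longrightarrow> enat k \<le> growth A m x a n \<longleftrightarrow> rch a k \<le> tau A m x n"
  unfolding growth_def by (intro le_value_iff tau_nonneg)

lemma growth_mono: "a \<in> {1..A} \<Longrightarrow> n \<le> n' \<Longrightarrow> growth A m x a n \<le> growth A m x a n'"
proof -
  assume a: "a \<in> {1..A}" and n: "n \<le> n'"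
  have *: "enat k \<le> growth A m x a n'" if "enat k \<le> growth A m x a n" for k
    using that le_growth_iff[OF a] tau_mono[OF n] by fastforce
  show ?thesis
  proof (cases "growth A m x a n")
    case (enat k)
    then show ?thesis using *[of k] by simp
  next
    case infinity
    then have "\<And>k. enat k \<le> growth A m x a n'" using * by simp
    then have "growth A m x a n' = \<infinity>" by (metis Suc_n_not_le_n enat_ord_simps(1) not_infinity_eq)
    then show ?thesis by simp
  qed
qed

lemma total_finite_iff:
  assumes "0 \<le> t"
  shows "total t < \<infinity> \<longleftrightarrow> (\<forall>a\<in>{1..A}. \<exists>k. t < rch a k)"
proof -
  have "agent_value (x a) (m a) t < \<infinity> \<longleftrightarrow> (\<exists>k. t < rch a k)" if "a \<in> {1..A}" for a
  proof -
    have "agent_value (x a) (m a) t < \<infinity> \<longleftrightarrow> (\<exists>k. \<not> enat k \<le> agent_value (x a) (m a) t)"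
      by (cases "agent_value (x a) (m a) t") (auto simp: not_le)
    then show ?thesis using le_value_iff[OF that assms] by (simp add: not_le)
  qed
  moreover have "total t < \<infinity> \<longleftrightarrow> (\<forall>a\<in>{1..A}. agent_value (x a) (m a) t < \<infinity>)"
  proof -
    have "sum v B < \<infinity> \<longleftrightarrow> (\<forall>a\<in>B. v a < \<infinity>)" if "finite B" for v :: "nat \<Rightarrow> enat" and B
      using that by induction (auto simp: plus_eq_infty_iff_enat)
    then show ?thesis by simp
  qed
  ultimately show ?thesis by simp
qed

text \<open>If no agent has exploded by time \<open>t\<close>, the total is finite and its successor
  is attained only later.\<close>

lemma less_tau_if:
  assumes "0 \<le> t" "\<forall>a\<in>{1..A}. \<exists>k. t < rch a k"
  shows "\<exists>n. t < tau A m x n"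
proof -
  obtain n where "total t = enat n" using total_finite_iff assms by (metis not_infinity_eq less_irrefl)
  then have "\<not> enat (Suc n) \<le> total t" by simp
  then show ?thesis using tau_le_iff[OF assms(1), of "Suc n"] by (auto simp: not_le)
qed

lemma growth_tendsto_infinity_iff:
  assumes "a \<in> {1..A}"
  shows "growth A m x a \<longlonglongrightarrow> \<infinity> \<longleftrightarrow> (\<forall>k. \<exists>n. rch a k \<le> tau A m x n)"
proof -
  have "growth A m x a \<longlonglongrightarrow> \<infinity> \<longleftrightarrow> (\<forall>k. eventually (\<lambda>n. enat k \<le> growth A m x a n) sequentially)"
  proof
    assume lim: "growth A m x a \<longlonglongrightarrow> \<infinity>"
    show "\<forall>k. eventually (\<lambda>n. enat k \<le> growth A m x a n) sequentially"
    proof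
      fix k
      show "eventually (\<lambda>n. enat k \<le> growth A m x a n) sequentially"
        using order_tendstoD(1)[OF lim, of "enat k"] by (auto elim: eventually_mono)
    qed
  next
    assume *: "\<forall>k. eventually (\<lambda>n. enat k \<le> growth A m x a n) sequentially"
    show "growth A m x a \<longlonglongrightarrow> \<infinity>"
    proof (rule order_tendstoI)
      fix y :: enat assume "y < \<infinity>"
      then obtain k where "y = enat k" by (cases y) auto
      then show "eventually (\<lambda>n. y < growth A m x a n) sequentially"
        using *[rule_format, of "Suc k"] by (elim eventually_mono) (auto simp: Suc_ile_eq)
    qed auto
  qed
  also have "\<dots> \<longleftrightarrow> (\<forall>k. \<exists>n. enat k \<le> growth A m x a n)"
    using growth_mono[OF assms] unfolding eventually_sequentially by (meson order_trans order_refl)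
  finally show ?thesis using le_growth_iff[OF assms] by simp
qed

lemma leadership_iff:
  "leadership A m x \<longleftrightarrow>
    (\<exists>a\<in>{1..A}. eventually (\<lambda>n. \<forall>b\<in>{1..A}. growth A m x b n \<le> growth A m x a n) sequentially)"
proof -
  have "growth A m x a n = Max ((\<lambda>a'. growth A m x a' n) ` {1..A}) \<longleftrightarrow>
      (\<forall>b\<in>{1..A}. growth A m x b n \<le> growth A m x a n)" if a: "a \<in> {1..A}" for a n
  proof
    assume *: "growth A m x a n = Max ((\<lambda>a'. growth A m x a' n) ` {1..A})"
    show "\<forall>b\<in>{1..A}. growth A m x b n \<le> growth A m x a n"
      unfolding * by simp
  next
    assume "\<forall>b\<in>{1..A}. growth A m x b n \<le> growth A m x a n"
    then show "growth A m x a n = Max ((\<lambda>a'. growth A m x a' n) ` {1..A})"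
      using a by (intro Max_eqI[symmetric]) auto
  qed
  then show ?thesis unfolding leadership_def by simp
qed

text \<open>
  Below the explosion time every time at which some agent jumps is one of the \<open>tau\<close>, so a reversed
  order of arrival at a single level is visible to the discrete process.
\<close>

lemma leader_reaches_first:
  assumes unbounded: "\<And>a t. a \<in> {1..A} \<Longrightarrow> \<exists>k. t < rch a k"
    and a: "a \<in> {1..A}" and b: "b \<in> {1..A}"
    and leader: "\<And>n. n \<ge> n0 \<Longrightarrow> growth A m x b n \<le> growth A m x a n"
    and k: "n0 \<le> k"
  shows "rch a k \<le> rch b k"
proof (rule ccontr)
  define t where "t = rch b k"
  assume "\<not> rch a k \<le> rch b k"
  then have less: "t < rch a k" unfolding t_def by simp
  have t0: "0 \<le> t" unfolding t_def using b by (rule rch_nonneg)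
  have "total t < \<infinity>" using total_finite_iff[OF t0] unbounded by simp
  then obtain n where n: "total t = enat n" by (cases "total t") auto
  define v where "v s c = agent_value (x c) (m c) s" for s c
  \<comment> \<open>Agent \<open>b\<close> alone contributes at least \<open>k\<close> to the total
    at \<open>t\<close>. Together with \<open>n0 \<le> k\<close> this puts \<open>n\<close> in the
    range where \<open>a\<close> leads.\<close>
  have "n \<ge> k"
  proof -
    have "enat k \<le> v t b" unfolding v_def using le_value_iff[OF b t0] by (simp add: t_def)
    also have "\<dots> \<le> total t" unfolding v_def using b by (intro member_le_sum) auto
    finally show ?thesis using n by simp
  qed
  have tau_le: "tau A m x n \<le> t" using tau_le_iff[OF t0] n by simp
  \<comment> \<open>At an earlier time \<open>b\<close> would still be below \<open>k\<close> and
    nobody above its value at \<open>t\<close>, so the total would be below \<open>n\<close>.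
    Strictness of this comparison relies on all values at \<open>t\<close> being finite.\<close>
  have "tau A m x n = t"
  proof (rule ccontr)
    assume "tau A m x n \<noteq> t"
    with tau_le have lt: "tau A m x n < t" by simp
    have le: "v (tau A m x n) c \<le> v t c" if "c \<in> {1..A}" for c
    proof (rule ccontr)
      assume "\<not> ?thesis"
      then have "v t c < v (tau A m x n) c" by simp
      then obtain l where l: "v t c = enat l" by (cases "v t c") auto
      with \<open>v t c < _\<close> have "enat (Suc l) \<le> v (tau A m x n) c" by (simp add: Suc_ile_eq)
      then have "enat (Suc l) \<le> v t c"
        using le_value_iff[OF that tau_nonneg] le_value_iff[OF that t0] tau_le
        unfolding v_def by fastforce
      then show False using l by simp
    qed
    have "\<not> enat k \<le> v (tau A m x n) b"
      unfolding v_def using le_value_iff[OF b tau_nonneg] lt by (simp add: t_def)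
    then have lt_b: "v (tau A m x n) b < v t b"
      using le_value_iff[OF b t0, of k] unfolding v_def by (auto simp: t_def)
    have fin: "v t c < \<infinity>" if "c \<in> {1..A}" for c
    proof -
      have "v t c \<le> total t" unfolding v_def using that by (intro member_le_sum) auto
      then show ?thesis using n by (cases "v t c") auto
    qed
    have "total (tau A m x n) < total t"
    proof -
      have enat_v: "enat (the_enat (v t c)) = v t c"
          "enat (the_enat (v (tau A m x n) c)) = v (tau A m x n) c" if "c \<in> {1..A}" for c
        using fin[OF that] le[OF that] by (cases "v t c"; cases "v (tau A m x n) c"; simp)+
      have tot: "total s = enat (\<Sum>c\<in>{1..A}. the_enat (v s c))"
        if "\<And>c. c \<in> {1..A} \<Longrightarrow> enat (the_enat (v s c)) = v s c" for s
      proof -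
        have "total s = (\<Sum>c\<in>{1..A}. enat (the_enat (v s c)))"
          using that unfolding v_def by (intro sum.cong) auto
        then show ?thesis
          using of_nat_sum[of "\<lambda>c. the_enat (v s c)" "{1..A}", where 'a = enat]
          by (simp add: of_nat_eq_enat)
      qed
      have "(\<Sum>c\<in>{1..A}. the_enat (v (tau A m x n) c)) < (\<Sum>c\<in>{1..A}. the_enat (v t c))"
      proof (rule sum_strict_mono_ex1)
        show "\<forall>c\<in>{1..A}. the_enat (v (tau A m x n) c) \<le> the_enat (v t c)"
          using le enat_v by (metis enat_ord_simps(1))
        show "\<exists>c\<in>{1..A}. the_enat (v (tau A m x n) c) < the_enat (v t c)"
          using lt_b b enat_v by (metis enat_ord_simps(2))
      qed simp
      then show ?thesis using tot enat_v by simp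
    qed
    then show False using n le_total_tau[of n] by simp
  qed
  then have "enat k \<le> growth A m x b n" "\<not> enat k \<le> growth A m x a n"
    using le_growth_iff a b less by (simp_all add: t_def)
  then show False using leader[of n] \<open>n \<ge> k\<close> k by (meson le_trans order_trans)
qed

lemma leadership_imp_ahead:
  assumes "\<And>a t. a \<in> {1..A} \<Longrightarrow> \<exists>k. t < rch a k" and "leadership A m x"
  shows "\<exists>a\<in>{1..A}. \<forall>b\<in>{1..A}. eventually (\<lambda>k. rch a k \<le> rch b k) sequentially"
proof -
  obtain a n0 where a: "a \<in> {1..A}"
    and lead: "\<And>n b. n \<ge> n0 \<Longrightarrow> b \<in> {1..A} \<Longrightarrow> growth A m x b n \<le> growth A m x a n"
    using assms(2) unfolding leadership_iff eventually_sequentially by blast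
  have "rch a k \<le> rch b k" if "b \<in> {1..A}" "k \<ge> n0" for b k
    using leader_reaches_first[OF assms(1) a that(1) lead that(2)] that by blast
  then show ?thesis using a unfolding eventually_sequentially by blast
qed

text \<open>Without explosion \<open>tau\<close> passes every arrival time, so agents 1 and 2 both
  tend to infinity.\<close>

lemma not_monopoly_if_unbounded:
  assumes "\<And>a t. a \<in> {1..A} \<Longrightarrow> \<exists>k. t < rch a k"
  shows "\<not> monopoly A m x"
proof -
  have "growth A m x a \<longlonglongrightarrow> \<infinity>" if a: "a \<in> {1..A}" for a
    unfolding growth_tendsto_infinity_iff[OF a]
    using less_tau_if[OF rch_nonneg[OF a]] assms by (meson less_imp_le)
  moreover have "1 \<in> {1..A}" "2 \<in> {1..A}" using agents by auto
  ultimately show ?thesis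
    unfolding monopoly_def by (metis n_not_Suc_n one_add_one plus_1_eq_Suc)
qed

end

section \<open>Consequences of finite values\<close>

locale finite_waiting_times = waiting_times +
  assumes growth_finite: "\<And>a n. a \<in> {1..A} \<Longrightarrow> growth A m x a n < \<infinity>"
begin

lemma tau_less_rch:
  assumes "a \<in> {1..A}" shows "\<exists>k. tau A m x n < rch a k"
proof -
  obtain k where "growth A m x a n = enat k" using growth_finite[OF assms, of n] by (cases "growth A m x a n") auto
  then have "\<not> enat (Suc k) \<le> growth A m x a n" by simp
  then show ?thesis using le_growth_iff[OF assms] by (auto simp: not_le)
qed

text \<open>Pigeonhole: if all values stayed bounded, the total could not reach \<open>n\<close> at
  \<open>tau n\<close> once \<open>n\<close> exceeds the sum of the bounds.\<close>

lemma ex_growth_tendsto_infinity: "\<exists>a\<in>{1..A}. growth A m x a \<longlonglongrightarrow> \<infinity>"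
proof (rule ccontr)
  assume "\<not> ?thesis"
  then have "\<forall>a\<in>{1..A}. \<exists>k. \<forall>n. growth A m x a n < enat k"
    using growth_tendsto_infinity_iff le_growth_iff by (metis not_le)
  then obtain k where k: "\<And>a n. a \<in> {1..A} \<Longrightarrow> growth A m x a n < enat (k a)" by metis
  define n where "n = Suc (sum k {1..A})"
  have "total (tau A m x n) \<le> (\<Sum>a\<in>{1..A}. enat (k a))"
    using k unfolding growth_def by (intro sum_mono) (auto intro: less_imp_le)
  also have "\<dots> = enat (sum k {1..A})"
    using of_nat_sum[of k "{1..A}", where 'a = enat] by (simp add: of_nat_eq_enat)
  also have "\<dots> < enat n" by (simp add: n_def)
  finally show False using le_total_tau[of n] by simp
qed

text \<open>An agent tending to infinity gets past each level \<open>k\<close> by some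
  \<open>tau n\<close>. If all its later waiting times were zero, it would complete every level by
  that same time and its value would be infinite.\<close>

lemma ex_not_eventually_constant:
  "\<exists>a\<in>{1..A}. \<forall>k. \<exists>j>k. 0 < x a j"
proof -
  obtain a where a: "a \<in> {1..A}" and "growth A m x a \<longlonglongrightarrow> \<infinity>"
    using ex_growth_tendsto_infinity by blast
  then have *: "\<exists>n. rch a k \<le> tau A m x n" for k using growth_tendsto_infinity_iff by blast
  have "\<exists>j>k. 0 < x a j" for k
  proof (rule ccontr)
    assume "\<not> ?thesis"
    then have z: "x a j = 0" if "j > k" for j
      using that x_nonneg[OF a, of j] by (metis le_less less_one linorder_not_less not_less0 not_gr_zero)
    obtain n where n: "rch a k \<le> tau A m x n" using * by blast
    obtain l where l: "tau A m x n < rch a l" using tau_less_rch[OF a] by blast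
    have "rch a l \<le> rch a k"
    proof (cases "l \<le> k")
      case True
      then show ?thesis using rch_mono[OF a] by blast
    next
      case False
      then have "(\<Sum>j=m a+1..l. x a j) = (\<Sum>j\<in>{m a+1..l} \<inter> {..k}. x a j)"
        using z by (intro sum.mono_neutral_right) auto
      also have "\<dots> \<le> (\<Sum>j=m a+1..k. x a j)"
        using x_nonneg[OF a] by (intro sum_mono2) auto
      finally show ?thesis unfolding reach_def .
    qed
    then show False using n l by simp
  qed
  then show ?thesis using a by blast
qed

end

section \<open>Sufficient conditions for leadership, strict leadership and monopoly\<close>

text \<open>Positive waiting times beyond every level keep the arrival times from attaining their
  limit. This is asked of all agents, although finite values of a single path only give it for
  one.\<close>

locale growing_waiting_times = finite_waiting_times +
  assumes x_pos: "\<And>a k. a \<in> {1..A} \<Longrightarrow> \<exists>j>k. 0 < x a j"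
begin

lemma rch_less:
  assumes a: "a \<in> {1..A}" shows "\<exists>k'. rch a k < rch a k'"
proof -
  obtain j where j: "j > max k (m a)" "0 < x a j" using x_pos[OF a] by blast
  then have "rch a j = rch a (j - 1) + x a j"
    unfolding reach_def by (cases j) auto
  then have "rch a k < rch a j" using rch_mono[OF a, of k "j - 1"] j by linarith
  then show ?thesis by blast
qed

text \<open>The right-hand side places every arrival time of \<open>a\<close> strictly before the
  limit of the arrival times of each agent. Nobody has exploded at such a moment, so some
  \<open>tau n\<close> lies beyond it.\<close>

lemma growth_tendsto_infinity_iff':
  assumes a: "a \<in> {1..A}"
  shows "growth A m x a \<longlonglongrightarrow> \<infinity> \<longleftrightarrow> (\<forall>b\<in>{1..A}. \<forall>k. \<exists>k'. rch a k < rch b k')"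
proof
  assume "growth A m x a \<longlonglongrightarrow> \<infinity>"
  then show "\<forall>b\<in>{1..A}. \<forall>k. \<exists>k'. rch a k < rch b k'"
    using tau_less_rch growth_tendsto_infinity_iff[OF a] by (meson order_le_less_trans)
next
  assume "\<forall>b\<in>{1..A}. \<forall>k. \<exists>k'. rch a k < rch b k'"
  then show "growth A m x a \<longlonglongrightarrow> \<infinity>"
    using less_tau_if[OF rch_nonneg[OF a]] unfolding growth_tendsto_infinity_iff[OF a]
    by (meson less_imp_le)
qed

lemma growth_tendsto_infinity_if_ahead:
  assumes a: "a \<in> {1..A}"
    and ahead: "\<And>b. b \<in> {1..A} \<Longrightarrow> eventually (\<lambda>k. rch a k \<le> rch b k) sequentially"
  shows "growth A m x a \<longlonglongrightarrow> \<infinity>"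
  unfolding growth_tendsto_infinity_iff'[OF a]
proof (intro ballI allI)
  fix b k assume b: "b \<in> {1..A}"
  obtain K where K: "\<And>k. k \<ge> K \<Longrightarrow> rch a k \<le> rch b k"
    using ahead[OF b] unfolding eventually_sequentially by blast
  obtain k' where "rch a k < rch a k'" using rch_less[OF a] by blast
  also have "rch a k' \<le> rch a (max k' K)" using rch_mono[OF a] by simp
  also have "\<dots> \<le> rch b (max k' K)" using K by simp
  finally show "\<exists>k'. rch a k < rch b k'" by blast
qed

text \<open>The shift \<open>d\<close> is 0 for leadership and 1 for strict leadership. As long as
  \<open>b\<close> is below \<open>K\<close> the order of arrival gives no information, but at late
  times \<open>a\<close> has already passed \<open>K + d\<close>.\<close>

lemma ahead_imp_growth_ge:
  assumes a: "a \<in> {1..A}" and b: "b \<in> {1..A}"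
    and lim: "growth A m x a \<longlonglongrightarrow> \<infinity>"
    and ahead: "eventually (\<lambda>k. rch a (k + d) \<le> rch b k) sequentially"
  shows "eventually (\<lambda>n. growth A m x b n + enat d \<le> growth A m x a n) sequentially"
proof -
  obtain K where K: "\<And>k. k \<ge> K \<Longrightarrow> rch a (k + d) \<le> rch b k"
    using ahead unfolding eventually_sequentially by blast
  have "eventually (\<lambda>n. enat (K + d) < growth A m x a n) sequentially"
    using order_tendstoD(1)[OF lim] by simp
  then show ?thesis
  proof (rule eventually_mono)
    fix n assume n: "enat (K + d) < growth A m x a n"
    obtain k where k: "growth A m x b n = enat k"
      using growth_finite[OF b, of n] by (cases "growth A m x b n") auto
    show "growth A m x b n + enat d \<le> growth A m x a n"
    proof (cases "k \<ge> K")
      case True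
      then have "rch a (k + d) \<le> tau A m x n"
        using K le_growth_iff[OF b, of k n] k by (metis order_refl order_trans)
      then show ?thesis using le_growth_iff[OF a] k by simp
    next
      case False
      then have "enat (k + d) \<le> enat (K + d)" by simp
      also have "\<dots> \<le> growth A m x a n" using n by simp
      finally show ?thesis using k by simp
    qed
  qed
qed

lemma leadership_if_ahead:
  assumes a: "a \<in> {1..A}"
    and ahead: "\<And>b. b \<in> {1..A} \<Longrightarrow> eventually (\<lambda>k. rch a k \<le> rch b k) sequentially"
  shows "leadership A m x"
proof -
  have "eventually (\<lambda>n. \<forall>b\<in>{1..A}. growth A m x b n \<le> growth A m x a n) sequentially"
    using ahead_imp_growth_ge[OF a _ growth_tendsto_infinity_if_ahead[OF a ahead], where d = 0] ahead
    by (intro eventually_ball_finite) (auto simp: zero_enat_def[symmetric])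
  then show ?thesis unfolding leadership_iff using a by blast
qed

text \<open>For \<open>k \<ge> m a\<close> the event in \<open>strict\<close> says that
  \<open>a\<close> has value exactly \<open>k\<close> when \<open>b\<close> arrives at
  \<open>k\<close>. Once \<open>a\<close> is ahead, its failure means that \<open>a\<close> arrives
  at \<open>k + 1\<close> no later than \<open>b\<close> at \<open>k\<close>.\<close>

lemma strict_leadership_if_ahead:
  assumes a: "a \<in> {1..A}"
    and ahead: "\<And>b. b \<in> {1..A} \<Longrightarrow> eventually (\<lambda>k. rch a k \<le> rch b k) sequentially"
    and strict: "\<And>b. b \<in> {1..A} \<Longrightarrow> b \<noteq> a \<Longrightarrow>
      eventually (\<lambda>k. \<not> (0 \<le> rch b k - rch a k \<and> rch b k - rch a k < x a (k + 1))) sequentially"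
  shows "strict_leadership A m x"
proof -
  have "eventually (\<lambda>n. growth A m x b n < growth A m x a n) sequentially"
    if b: "b \<in> {1..A}" "b \<noteq> a" for b
  proof -
    have step: "rch a (k + 1) = rch a k + x a (k + 1)" if "k \<ge> m a" for k
      using that unfolding reach_def by simp
    have "eventually (\<lambda>k. rch a (k + 1) \<le> rch b k) sequentially"
      using ahead[OF b(1)] strict[OF b] eventually_ge_at_top[of "m a"]
    proof eventually_elim
      case (elim k)
      then show ?case using step[of k] by linarith
    qed
    from ahead_imp_growth_ge[OF a b(1) growth_tendsto_infinity_if_ahead[OF a ahead] this]
    show ?thesis
    proof (rule eventually_mono)
      fix n assume le: "growth A m x b n + enat 1 \<le> growth A m x a n"
      obtain k where "growth A m x b n = enat k"
        using growth_finite[OF b(1), of n] by (cases "growth A m x b n") auto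
      then show "growth A m x b n < growth A m x a n" using le by (simp add: Suc_ile_eq)
    qed
  qed
  then have "eventually (\<lambda>n. \<forall>b\<in>{1..A}. b \<noteq> a \<longrightarrow> growth A m x b n < growth A m x a n) sequentially"
    by (intro eventually_ball_finite) auto
  then show ?thesis unfolding strict_leadership_def using a by blast
qed

text \<open>Pairwise comparability makes ``eventually no later'' a total preorder on the agents.\<close>

lemma ex_ahead:
  assumes total: "\<And>a b. a \<in> {1..A} \<Longrightarrow> b \<in> {1..A} \<Longrightarrow>
      eventually (\<lambda>k. rch a k \<le> rch b k) sequentially \<or>
      eventually (\<lambda>k. rch b k \<le> rch a k) sequentially"
  shows "\<exists>a\<in>{1..A}. \<forall>b\<in>{1..A}. eventually (\<lambda>k. rch a k \<le> rch b k) sequentially"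
proof -
  have "B \<noteq> {} \<Longrightarrow> B \<subseteq> {1..A} \<Longrightarrow>
      \<exists>a\<in>B. \<forall>b\<in>B. eventually (\<lambda>k. rch a k \<le> rch b k) sequentially" if "finite B" for B
    using that
  proof (induction B rule: finite_induct)
    case (insert c B)
    show ?case
    proof (cases "B = {}")
      case False
      then obtain a where a: "a \<in> B" "\<forall>b\<in>B. eventually (\<lambda>k. rch a k \<le> rch b k) sequentially"
        using insert by auto
      show ?thesis
      proof (cases "eventually (\<lambda>k. rch a k \<le> rch c k) sequentially")
        case True
        then show ?thesis using a by blast
      next
        case False
        then have ca: "eventually (\<lambda>k. rch c k \<le> rch a k) sequentially"
          using total[of a c] a insert.prems by blast
        have "eventually (\<lambda>k. rch c k \<le> rch b k) sequentially" if "b \<in> B" for b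
          using ca a(2)[rule_format, OF that] by eventually_elim simp
        then show ?thesis by auto
      qed
    qed auto
  qed simp
  then show ?thesis using agents by simp
qed

text \<open>Arrival times stay strictly below the total \<open>T\<close>, so every arrival time of
  \<open>a\<close> is followed by one of \<open>b\<close> iff \<open>T a \<le> T b\<close>. The
  agents tending to infinity are thus the minimisers of \<open>T\<close>.\<close>

lemma monopoly_if_distinct:
  assumes summable: "\<And>a. a \<in> {1..A} \<Longrightarrow> rch a \<longlonglongrightarrow> T a"
    and distinct: "\<And>a b. a \<in> {1..A} \<Longrightarrow> b \<in> {1..A} \<Longrightarrow> a \<noteq> b \<Longrightarrow> T a \<noteq> T b"
  shows "monopoly A m x"
proof -
  have le: "rch a k \<le> T a" if "a \<in> {1..A}" for a k
    using summable[OF that] rch_mono[OF that] by (intro incseq_le) (auto simp: incseq_def)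
  have less: "rch a k < T a" if "a \<in> {1..A}" for a k
    using rch_less[OF that, of k] le[OF that] by (meson order_less_le_trans)
  have iff: "growth A m x a \<longlonglongrightarrow> \<infinity> \<longleftrightarrow> (\<forall>b\<in>{1..A}. T a \<le> T b)" if a: "a \<in> {1..A}" for a
  proof -
    have "(\<forall>k. \<exists>k'. rch a k < rch b k') \<longleftrightarrow> T a \<le> T b" if b: "b \<in> {1..A}" for b
    proof
      assume "\<forall>k. \<exists>k'. rch a k < rch b k'"
      then have "rch a k \<le> T b" for k using le[OF b] by (meson less_imp_le order_trans)
      then show "T a \<le> T b" by (intro LIMSEQ_le_const2[OF summable[OF a]]) auto
    next
      assume T: "T a \<le> T b"
      show "\<forall>k. \<exists>k'. rch a k < rch b k'"
      proof
        fix k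
        have "rch a k < T b" using less[OF a, of k] T by simp
        from order_tendstoD(1)[OF summable[OF b] this]
        show "\<exists>k'. rch a k < rch b k'" unfolding eventually_sequentially by blast
      qed
    qed
    then show ?thesis using growth_tendsto_infinity_iff'[OF a] by blast
  qed
  show ?thesis
    unfolding monopoly_def
  proof (rule ex_ex1I)
    show "\<exists>a. a \<in> {1..A} \<and> growth A m x a \<longlonglongrightarrow> \<infinity>" using ex_growth_tendsto_infinity by blast
    show "a = b" if "a \<in> {1..A} \<and> growth A m x a \<longlonglongrightarrow> \<infinity>" "b \<in> {1..A} \<and> growth A m x b \<longlonglongrightarrow> \<infinity>" for a b
      using that iff distinct by (metis order_antisym)
  qed
qed

end

section \<open>Series of independent symmetric random variables\<close>

abbreviation real_seq :: "(nat \<Rightarrow> real) measure" where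
  "real_seq \<equiv> Pi\<^sub>M UNIV (\<lambda>_. borel)"

lemma pred_summable [measurable]:
  fixes f :: "'a \<Rightarrow> nat \<Rightarrow> real"
  assumes [measurable]: "\<And>i. (\<lambda>x. f x i) \<in> borel_measurable M"
  shows "Measurable.pred M (\<lambda>x. summable (f x))"
  using sets_Collect_Cauchy[of "\<lambda>n x. \<Sum>i<n. f x i" M]
  by (simp add: pred_def summable_iff_convergent Cauchy_convergent_iff)

lemma measurable_seq:
  assumes "\<And>i. X i \<in> borel_measurable M"
  shows "(\<lambda>\<omega> i. X i \<omega>) \<in> measurable M real_seq"
  using assms by (intro measurable_PiM_single') (auto simp: PiE_def)

lemma flip_measurable: "(\<lambda>f. f(i := - f i)) \<in> measurable real_seq real_seq"
proof -
  have "(\<lambda>f j. (if j = i then - f j else f j)) \<in> measurable real_seq real_seq"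
    by (intro measurable_seq) auto
  moreover have "(\<lambda>f j. (if j = i then - f j else f j :: real)) = (\<lambda>f. f(i := - f i))"
    by (auto simp: fun_eq_iff)
  ultimately show ?thesis by simp
qed

text \<open>Kolmogorov's 0-1 law for predicates on sequences. Invariance under erasing the first
  \<open>N\<close> entries lets the event be written, for every \<open>n\<close>, through the
  variables from \<open>n\<close> on, which makes it a tail event.\<close>

lemma (in prob_space) zero_one_law_seq:
  fixes X :: "nat \<Rightarrow> 'a \<Rightarrow> real"
  assumes indep: "indep_vars (\<lambda>_. borel) X UNIV"
    and Q [measurable]: "Measurable.pred real_seq Q"
    and tail: "\<And>N f. Q (\<lambda>i. if i < N then 0 else f i) \<longleftrightarrow> Q f"
  shows "(AE \<omega> in M. Q (\<lambda>i. X i \<omega>)) \<or> (AE \<omega> in M. \<not> Q (\<lambda>i. X i \<omega>))"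
proof -
  have X [measurable]: "\<And>i. X i \<in> borel_measurable M"
    using indep by (auto simp: indep_vars_def)
  note [measurable] = measurable_seq[of X M, OF X]
  define \<A> where "\<A> i = sigma_sets (space M) {X i -` B \<inter> space M | B. B \<in> sets borel}" for i
  define E where "E = {\<omega> \<in> space M. Q (\<lambda>i. X i \<omega>)}"
  have E [measurable]: "E \<in> sets M" unfolding E_def by measurable
  have "prob E = 0 \<or> prob E = 1"
  proof (rule kolmogorov_0_1_law[of \<A>])
    show "sigma_algebra (space M) (\<A> i)" for i
      unfolding \<A>_def by (intro sigma_algebra_sigma_sets) auto
    show "indep_sets \<A> UNIV"
      using indep unfolding \<A>_def indep_vars_def by simp
    show "E \<in> tail_events \<A>"
      unfolding tail_events_def
    proof
      fix n
      define S where "S = sigma (space M) (\<Union> (\<A> ` {n..}))"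
      have sub: "\<Union> (\<A> ` {n..}) \<subseteq> Pow (space M)"
        unfolding \<A>_def by (auto dest: sigma_sets_into_sp[rotated])
      have sp: "space S = space M" and se: "sets S = sigma_sets (space M) (\<Union> (\<A> ` {n..}))"
        unfolding S_def using sub by (auto simp: space_measure_of sets_measure_of)
      have "(\<lambda>\<omega>. if i < n then 0 else X i \<omega>) \<in> borel_measurable S" for i
      proof (cases "i < n")
        case False
        have "X i \<in> borel_measurable S"
        proof (rule measurableI)
          fix B :: "real set" assume "B \<in> sets borel"
          then have "X i -` B \<inter> space M \<in> \<A> i" unfolding \<A>_def by (intro sigma_sets.Basic) auto
          then show "X i -` B \<inter> space S \<in> sets S"
            unfolding se sp using False by (intro sigma_sets.Basic) auto
        qed simp
        then show ?thesis using False by simp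
      qed simp
      from measurable_seq[OF this]
      have "{\<omega> \<in> space S. Q (\<lambda>i. if i < n then 0 else X i \<omega>)} \<in> sets S"
        using Q unfolding pred_def[symmetric] by (rule measurable_compose)
      then show "E \<in> sigma_sets (space M) (\<Union> (\<A> ` {n..}))"
        unfolding tail sp se E_def .
    qed
  qed
  then show ?thesis
  proof
    assume "prob E = 1"
    then have "AE \<omega> in M. \<omega> \<in> E" by (simp add: prob_eq_1)
    then show ?thesis unfolding E_def by (auto elim: AE_mp)
  next
    assume "prob E = 0"
    then have "AE \<omega> in M. \<omega> \<notin> E" by (simp add: prob_eq_0)
    then have "AE \<omega> in M. \<not> Q (\<lambda>i. X i \<omega>)" using AE_space by eventually_elim (auto simp: E_def)
    then show ?thesis by simp
  qed
qed

section \<open>Sign flips and zero sums\<close>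

lemma (in prob_space) distr_seq_eq_PiM:
  fixes X :: "nat \<Rightarrow> 'a \<Rightarrow> real"
  assumes "indep_vars (\<lambda>_. borel) X UNIV"
  shows "distr M real_seq (\<lambda>\<omega> i. X i \<omega>) = Pi\<^sub>M UNIV (\<lambda>i. distr M borel (X i))"
  using assms indep_vars_iff_distr_eq_PiM'[where I = UNIV and M' = "\<lambda>_. borel" and X = X]
  by (auto simp: indep_vars_def restrict_UNIV)

text \<open>By independence the joint law is the product of the marginals, and none of these
  changes.\<close>

lemma (in prob_space) distr_flip:
  fixes X :: "nat \<Rightarrow> 'a \<Rightarrow> real"
  assumes indep: "indep_vars (\<lambda>_. borel) X UNIV"
    and sym: "\<And>i. i \<in> I \<Longrightarrow> distr M borel (\<lambda>\<omega>. - X i \<omega>) = distr M borel (X i)"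
  shows "distr M real_seq (\<lambda>\<omega> i. if i \<in> I then - X i \<omega> else X i \<omega>) = distr M real_seq (\<lambda>\<omega> i. X i \<omega>)"
proof -
  have "indep_vars (\<lambda>_. borel) (\<lambda>i \<omega>. if i \<in> I then - X i \<omega> else X i \<omega>) UNIV"
    using indep_vars_compose2[OF indep, of "\<lambda>i x. if i \<in> I then - x else x" "\<lambda>_. borel"] by simp
  moreover have "distr M borel (\<lambda>\<omega>. if i \<in> I then - X i \<omega> else X i \<omega>) = distr M borel (X i)" for i
    using sym[of i] by (cases "i \<in> I") auto
  ultimately show ?thesis using indep by (simp add: distr_seq_eq_PiM)
qed

text \<open>
  Flipping the sign of the first nonzero entry beyond \<open>n\<close> preserves the law, and turns a series
  with sum \<open>0\<close> into one whose sum is twice one of its own late, nonzero entries. A fixed series has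
  this property for finitely many \<open>n\<close> only.
\<close>

lemma AE_sums_zero_imp_eventually_zero:
  fixes P :: "(nat \<Rightarrow> real) measure"
  assumes P: "prob_space P" and sets_P [measurable_cong]: "sets P = sets real_seq"
    and flip: "\<And>i. i \<ge> N \<Longrightarrow> distr P P (\<lambda>f. f(i := - f i)) = P"
  shows "AE f in P. f sums 0 \<longrightarrow> eventually (\<lambda>i. f i = 0) sequentially"
proof -
  interpret prob_space P by (rule P)
  have [measurable]: "(\<lambda>f. f i) \<in> borel_measurable P" for i by measurable
  have flip_meas [measurable]: "(\<lambda>f. f(i := - f i)) \<in> measurable P P" for i
    using flip_measurable sets_P by (simp cong: measurable_cong_sets)
  \<comment> \<open>\<open>Q\<close> is the bad event: sum zero, yet infinitely many nonzero
    entries. \<open>J n i\<close> says that \<open>i\<close> is the first index from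
    \<open>n\<close> on with a nonzero entry.\<close>
  define Q where "Q f \<longleftrightarrow> (summable f \<and> suminf f = 0) \<and> (\<forall>n. \<exists>i\<ge>n. f i \<noteq> 0)" for f :: "nat \<Rightarrow> real"
  define J where "J n i f \<longleftrightarrow> n \<le> i \<and> f i \<noteq> 0 \<and> (\<forall>k\<in>{n..<i}. f k = 0)" for n i and f :: "nat \<Rightarrow> real"
  have [measurable]: "Measurable.pred P Q" unfolding Q_def by measurable
  have [measurable]: "Measurable.pred P (J n i)" for n i unfolding J_def by measurable
  have [measurable]: "Measurable.pred P (\<lambda>f. Q (f(i := - f i)))" for i
    by (rule measurable_compose[OF flip_meas]) measurable
  define E where "E n i = {f \<in> space P. J n i f \<and> Q f}" for n i
  define F where "F n i = {f \<in> space P. J n i f \<and> Q (f(i := - f i))}" for n i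
  have [measurable]: "E n i \<in> sets P" "F n i \<in> sets P" for n i unfolding E_def F_def by measurable
  have J_unique: "i = i'" if "J n i f" "J n i' f" for n i i' f
    using that unfolding J_def by (metis atLeastLessThan_iff linorder_neqE_nat)
  have disj: "disjoint_family (E n)" "disjoint_family (F n)" for n
    unfolding disjoint_family_on_def E_def F_def using J_unique by blast+
  have EF: "emeasure P (F n i) = emeasure P (E n i)" if "n \<ge> N" for n i
  proof (cases "i \<ge> n")
    case True
    have "emeasure P (E n i) = emeasure (distr P P (\<lambda>f. f(i := - f i))) (E n i)"
      using flip[of i] True that by simp
    also have "\<dots> = emeasure P ((\<lambda>f. f(i := - f i)) -` E n i \<inter> space P)"
      by (rule emeasure_distr) auto
    \<comment> \<open>The flip changes neither which entries vanish nor, therefore,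
      \<open>J n i\<close>; so the preimage of \<open>E n i\<close> is \<open>F n i\<close>.\<close>
    also have "(\<lambda>f. f(i := - f i)) -` E n i \<inter> space P = F n i"
      using measurable_space[OF flip_meas] unfolding E_def F_def J_def by auto
    finally show ?thesis by simp
  next
    case False
    then show ?thesis unfolding E_def F_def J_def by simp
  qed
  define B where "B n = (\<Union>i. F n i)" for n
  have [measurable]: "B n \<in> sets P" for n unfolding B_def by measurable
  have UN_E: "(\<Union>i. E n i) = {f \<in> space P. Q f}" for n
  proof
    show "{f \<in> space P. Q f} \<subseteq> (\<Union>i. E n i)"
    proof
      fix f assume f: "f \<in> {f \<in> space P. Q f}"
      define i where "i = (LEAST i. n \<le> i \<and> f i \<noteq> 0)"
      have "\<exists>i\<ge>n. f i \<noteq> 0" using f unfolding Q_def by blast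
      then have "n \<le> i \<and> f i \<noteq> 0" unfolding i_def by (rule LeastI_ex)
      moreover have "f k = 0" if "n \<le> k" "k < i" for k
        using not_less_Least[of k "\<lambda>i. n \<le> i \<and> f i \<noteq> 0"] that unfolding i_def by blast
      ultimately have "J n i f" unfolding J_def by auto
      then show "f \<in> (\<Union>i. E n i)" using f unfolding E_def by blast
    qed
  qed (auto simp: E_def)
  \<comment> \<open>For each \<open>n\<close> the sets \<open>E n i\<close> partition the bad event,
    and the disjoint sets \<open>F n i\<close> have the same measures. Hence every
    \<open>B n\<close> with \<open>n \<ge> N\<close> is as large as the bad event.\<close>
  have B: "emeasure P (B n) = emeasure P {f \<in> space P. Q f}" if "n \<ge> N" for n
  proof -
    have "emeasure P (B n) = (\<Sum>i. emeasure P (F n i))"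
      unfolding B_def by (intro suminf_emeasure[symmetric] disj) auto
    also have "\<dots> = (\<Sum>i. emeasure P (E n i))" using EF[OF that] by simp
    also have "\<dots> = emeasure P (\<Union>i. E n i)" by (intro suminf_emeasure disj) auto
    finally show ?thesis unfolding UN_E .
  qed
  define G where "G k = (\<Union>n\<in>{k..}. B n)" for k
  have [measurable]: "G k \<in> sets P" for k unfolding G_def by measurable
  \<comment> \<open>Membership in \<open>B n\<close> makes the sum of \<open>f\<close> equal to
    twice a nonzero entry at an index \<open>\<ge> n\<close>. Membership for infinitely many
    \<open>n\<close> would repeat this same nonzero entry arbitrarily late, although the entries
    tend to 0.\<close>
  have "(\<Inter>k. G k) = {}"
  proof (rule ccontr)
    assume "\<not> ?thesis"
    then obtain f where "\<And>k. f \<in> G k" by blast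
    then have f: "\<exists>n\<ge>k. \<exists>i. J n i f \<and> Q (f(i := - f i))" for k
      unfolding G_def B_def F_def by blast
    have sums: "f sums (2 * f i)" "f i \<noteq> 0" if "J n i f" "Q (f(i := - f i))" for n i
    proof -
      have "(f(i := - f i)) sums 0" using that(2) unfolding Q_def by (metis summable_sums)
      moreover have "(\<lambda>k. if k = i then 2 * f k else 0) sums (2 * f i)"
        by (rule sums_single)
      ultimately have "(\<lambda>k. (f(i := - f i)) k + (if k = i then 2 * f k else 0)) sums (0 + 2 * f i)"
        by (rule sums_add)
      also have "(\<lambda>k. (f(i := - f i)) k + (if k = i then 2 * f k else 0)) = f" by auto
      finally show "f sums (2 * f i)" by simp
      show "f i \<noteq> 0" using that(1) unfolding J_def by blast
    qed
    obtain n i where ni: "J n i f" "Q (f(i := - f i))" using f by blast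
    have "f \<longlonglongrightarrow> 0" using sums(1)[OF ni] by (intro summable_LIMSEQ_zero sums_summable)
    moreover have "0 < \<bar>f i\<bar>" using sums(2)[OF ni] by simp
    ultimately have "eventually (\<lambda>k. \<bar>f k\<bar> < \<bar>f i\<bar>) sequentially"
      by (intro order_tendstoD(2)[OF tendsto_rabs_zero]) auto
    then obtain K where K: "\<And>k. k \<ge> K \<Longrightarrow> \<bar>f k\<bar> < \<bar>f i\<bar>"
      unfolding eventually_sequentially by blast
    obtain n' i' where ni': "n' \<ge> K" "J n' i' f" "Q (f(i' := - f i'))" using f by blast
    have "f i' = f i" using sums_unique2[OF sums(1)[OF ni] sums(1)[OF ni'(2,3)]] by simp
    moreover have "i' \<ge> K" using ni' unfolding J_def by simp
    ultimately show False using K[of i'] by simp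
  qed
  moreover have "decseq G"
    unfolding G_def unfolding decseq_def by (intro allI impI UN_mono) auto
  then have "(\<lambda>k. measure P (G k)) \<longlonglongrightarrow> measure P (\<Inter>k. G k)"
    by (intro finite_Lim_measure_decseq) auto
  ultimately have "(\<lambda>k. measure P (G k)) \<longlonglongrightarrow> 0" by simp
  moreover have "measure P {f \<in> space P. Q f} \<le> measure P (G k)" if "k \<ge> N" for k
  proof -
    have "measure P {f \<in> space P. Q f} = measure P (B k)" using B[OF that] by (simp add: measure_def)
    also have "\<dots> \<le> measure P (G k)" by (intro finite_measure_mono) (auto simp: G_def)
    finally show ?thesis .
  qed
  ultimately have "measure P {f \<in> space P. Q f} \<le> 0"
    by (intro LIMSEQ_le_const[of "\<lambda>k. measure P (G k)"]) auto
  then have "prob {f \<in> space P. Q f} = 0" by (simp add: measure_le_0_iff)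
  moreover have "{f \<in> space P. Q f} \<in> sets P" by measurable
  ultimately have "AE f in P. \<not> Q f" using AE_space by (auto simp: prob_eq_0)
  then show ?thesis
    by (rule AE_mp) (auto simp: Q_def sums_iff eventually_sequentially)
qed

text \<open>Symmetry is asked for from \<open>N\<close> on only: when initial values differ,
  finitely many early waiting times of one agent have no counterpart for the other.\<close>

lemma (in prob_space) AE_symmetric_sums_zero:
  fixes X :: "nat \<Rightarrow> 'a \<Rightarrow> real"
  assumes indep: "indep_vars (\<lambda>_. borel) X UNIV"
    and sym: "\<And>i. i \<ge> N \<Longrightarrow> distr M borel (\<lambda>\<omega>. - X i \<omega>) = distr M borel (X i)"
  shows "AE \<omega> in M. (\<lambda>i. X i \<omega>) sums 0 \<longrightarrow> eventually (\<lambda>i. X i \<omega> = 0) sequentially"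
proof -
  have X [measurable]: "\<And>i. X i \<in> borel_measurable M"
    using indep by (auto simp: indep_vars_def)
  note Xseq [measurable] = measurable_seq[of X M, OF X]
  define P where "P = distr M real_seq (\<lambda>\<omega> i. X i \<omega>)"
  have P: "prob_space P" unfolding P_def by (intro prob_space_distr Xseq)
  have sets_P: "sets P = sets real_seq" unfolding P_def by simp
  have "distr P P (\<lambda>f. f(i := - f i)) = P" if "i \<ge> N" for i
  proof -
    note [measurable] = flip_measurable[of i]
    have "distr P P (\<lambda>f. f(i := - f i)) = distr P real_seq (\<lambda>f. f(i := - f i))"
      using sets_P by (intro distr_cong) auto
    also have "\<dots> = distr M real_seq (\<lambda>\<omega>. (\<lambda>j. X j \<omega>)(i := - X i \<omega>))"
      unfolding P_def by (subst distr_distr) (auto simp: comp_def)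
    also have "\<dots> = distr M real_seq (\<lambda>\<omega> j. if j \<in> {i} then - X j \<omega> else X j \<omega>)"
      by (rule arg_cong[where f = "distr M real_seq"]) (auto simp: fun_eq_iff)
    also have "\<dots> = P" unfolding P_def using sym that by (intro distr_flip[OF indep]) auto
    finally show ?thesis .
  qed
  from AE_sums_zero_imp_eventually_zero[OF P sets_P this]
  have "AE f in P. f sums 0 \<longrightarrow> eventually (\<lambda>i. f i = 0) sequentially" .
  then show ?thesis
    unfolding P_def by (rule AE_distrD[OF Xseq])
qed

section \<open>Partial sums stopped on leaving an interval\<close>

definition psum :: "(nat \<Rightarrow> real) \<Rightarrow> nat \<Rightarrow> real" where
  "psum f n = (\<Sum>i<n. f i)"

text \<open>This depends on the entries before \<open>n\<close> only, so for independent entries it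
  is independent of entry \<open>n\<close>.\<close>

definition contained :: "real \<Rightarrow> (nat \<Rightarrow> real) \<Rightarrow> nat \<Rightarrow> bool" where
  "contained c f n \<longleftrightarrow> (\<forall>k\<le>n. \<bar>psum f k\<bar> \<le> c)"

text \<open>The partial sum stopped at its first exit from \<open>{-c..c}\<close>, the exit value included.\<close>

definition stopped_sum :: "real \<Rightarrow> (nat \<Rightarrow> real) \<Rightarrow> nat \<Rightarrow> real" where
  "stopped_sum c f n = (\<Sum>i<n. if contained c f i then f i else 0)"

lemma psum_measurable [measurable]: "(\<lambda>f. psum f n) \<in> borel_measurable real_seq"
  unfolding psum_def by measurable

lemma contained_measurable [measurable]: "Measurable.pred real_seq (\<lambda>f. contained c f n)"
  unfolding contained_def by measurable

lemma stopped_sum_measurable [measurable]: "(\<lambda>f. stopped_sum c f n) \<in> borel_measurable real_seq"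
  unfolding stopped_sum_def by measurable

lemma psum_cong: "(\<And>i. i < n \<Longrightarrow> f i = g i) \<Longrightarrow> psum f n = psum g n"
  unfolding psum_def by (intro sum.cong) auto

lemma contained_cong:
  "(\<And>i. i < n \<Longrightarrow> f i = g i) \<Longrightarrow> contained c f n \<longleftrightarrow> contained c g n"
  unfolding contained_def using psum_cong[where f = f and g = g] by (metis order_less_le_trans)

lemma contained_antimono: "contained c f n \<Longrightarrow> m \<le> n \<Longrightarrow> contained c f m"
  unfolding contained_def by simp

lemma stopped_sum_cong:
  "(\<And>i. i < n \<Longrightarrow> f i = g i) \<Longrightarrow> stopped_sum c f n = stopped_sum c g n"
  unfolding stopped_sum_def
proof (intro sum.cong)
  fix i assume *: "\<And>i. i < n \<Longrightarrow> f i = g i" and i: "i \<in> {..<n}"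
  then have "contained c f i \<longleftrightarrow> contained c g i" by (intro contained_cong) auto
  then show "(if contained c f i then f i else 0) = (if contained c g i then g i else 0)"
    using * i by simp
qed simp

text \<open>After the exit the stopped sum is frozen, and the exit overshoots \<open>c\<close> by at
  most one increment.\<close>

lemma stopped_sum_cases:
  assumes "0 \<le> c" and b: "\<And>i. \<bar>f i\<bar> \<le> b"
  shows "contained c f n \<and> stopped_sum c f n = psum f n \<or>
    \<not> contained c f n \<and> c < \<bar>stopped_sum c f n\<bar> \<and> \<bar>stopped_sum c f n\<bar> \<le> c + b"
proof (induction n)
  case 0
  then show ?case using assms by (simp add: contained_def stopped_sum_def psum_def)
next
  case (Suc n)
  have contained_Suc: "contained c f (Suc n) \<longleftrightarrow> contained c f n \<and> \<bar>psum f (Suc n)\<bar> \<le> c"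
    unfolding contained_def by (auto simp: le_Suc_eq)
  have stopped_Suc: "stopped_sum c f (Suc n) = stopped_sum c f n + (if contained c f n then f n else 0)"
    by (simp add: stopped_sum_def)
  show ?case
  proof (cases "contained c f n")
    case True
    then have "stopped_sum c f (Suc n) = psum f (Suc n)"
      using Suc stopped_Suc by (simp add: psum_def)
    moreover have "\<bar>psum f n\<bar> \<le> c" using True unfolding contained_def by simp
    moreover have "psum f (Suc n) = psum f n + f n" by (simp add: psum_def)
    ultimately show ?thesis using True contained_Suc b[of n] by auto
  next
    case False
    then show ?thesis using Suc contained_Suc stopped_Suc by simp
  qed
qed

lemma abs_stopped_sum_le:
  assumes "0 \<le> c" and b: "\<And>i. \<bar>f i\<bar> \<le> b"
  shows "\<bar>stopped_sum c f n\<bar> \<le> c + b"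
proof -
  have "0 \<le> b" using b[of 0] by linarith
  moreover have "contained c f n \<Longrightarrow> \<bar>psum f n\<bar> \<le> c" unfolding contained_def by simp
  ultimately show ?thesis using stopped_sum_cases[of c f b n, OF assms] by auto
qed

text \<open>The condition \<open>past\<close> expresses that \<open>g\<close> reads the first
  \<open>n\<close> entries only: \<open>g\<close> then factors through the restriction to
  \<open>{..<n}\<close>, which is independent of \<open>Z n\<close>.\<close>

lemma (in prob_space) indep_past:
  fixes Z :: "nat \<Rightarrow> 'a \<Rightarrow> real"
  assumes indep: "indep_vars (\<lambda>_. borel) Z UNIV"
    and g: "g \<in> borel_measurable real_seq"
    and past: "\<And>f. g (\<lambda>i. if i < n then f i else 0) = g f"
  shows "indep_var borel (\<lambda>\<omega>. g (\<lambda>i. Z i \<omega>)) borel (Z n)"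
proof -
  have cut: "(\<lambda>f i. if i < n then f i else 0) \<in> measurable (Pi\<^sub>M {..<n} (\<lambda>_. borel)) real_seq"
  proof (rule measurable_seq)
    fix i
    show "(\<lambda>f. if i < n then f i else 0) \<in> borel_measurable (Pi\<^sub>M {..<n} (\<lambda>_. borel :: real measure))"
      by (cases "i < n") auto
  qed
  have "indep_var borel ((\<lambda>f. g (\<lambda>i. if i < n then f i else 0)) \<circ> (\<lambda>\<omega>. restrict (\<lambda>i. Z i \<omega>) {..<n}))
      borel ((\<lambda>f. f n) \<circ> (\<lambda>\<omega>. restrict (\<lambda>i. Z i \<omega>) {n}))"
    by (intro indep_var_compose[OF indep_var_restrict[OF indep]] measurable_compose[OF cut g]) auto
  moreover have "(\<lambda>f. g (\<lambda>i. if i < n then f i else 0)) \<circ> (\<lambda>\<omega>. restrict (\<lambda>i. Z i \<omega>) {..<n}) =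
      (\<lambda>\<omega>. g (\<lambda>i. Z i \<omega>))"
  proof
    fix \<omega>
    have "(\<lambda>i. if i < n then restrict (\<lambda>i. Z i \<omega>) {..<n} i else 0) = (\<lambda>i. if i < n then Z i \<omega> else 0)"
      by auto
    then show "((\<lambda>f. g (\<lambda>i. if i < n then f i else 0)) \<circ> (\<lambda>\<omega>. restrict (\<lambda>i. Z i \<omega>) {..<n})) \<omega> = g (\<lambda>i. Z i \<omega>)"
      using past[of "\<lambda>i. Z i \<omega>"] by (simp del: restrict_apply)
  qed
  moreover have "(\<lambda>f. f n) \<circ> (\<lambda>\<omega>. restrict (\<lambda>i. Z i \<omega>) {n}) = Z n" by auto
  ultimately show ?thesis by simp
qed

lemma (in prob_space) indep_vars_shift:
  fixes Z :: "nat \<Rightarrow> 'a \<Rightarrow> real"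
  assumes "indep_vars (\<lambda>_. borel) Z UNIV"
  shows "indep_vars (\<lambda>_. borel) (\<lambda>i. Z (N + i)) UNIV"
proof -
  have "indep_vars (\<lambda>j. Pi\<^sub>M {N + j} (\<lambda>_. borel)) (\<lambda>j \<omega>. restrict (\<lambda>i. Z i \<omega>) {N + j}) UNIV"
    by (intro indep_vars_restrict[OF assms]) (auto simp: disjoint_family_on_def)
  from indep_vars_compose2[OF this, of "\<lambda>j f. f (N + j)" "\<lambda>_. borel"] show ?thesis by simp
qed

section \<open>Second moments and convergence for bounded centred increments\<close>

locale bounded_centered = prob_space +
  fixes Z :: "nat \<Rightarrow> 'a \<Rightarrow> real" and b :: real
  assumes indep_Z: "indep_vars (\<lambda>_. borel) Z UNIV"
    and bounded_Z: "\<And>i \<omega>. \<bar>Z i \<omega>\<bar> \<le> b"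
    and mean_Z: "\<And>i. expectation (Z i) = 0"
begin

lemma Z_measurable [measurable]: "Z i \<in> borel_measurable M"
  using indep_Z by (auto simp: indep_vars_def)

lemma Z_seq_measurable [measurable]: "(\<lambda>\<omega> i. Z i \<omega>) \<in> measurable M real_seq"
  by (intro measurable_seq Z_measurable)

lemma bounded_centered_shift: "bounded_centered M (\<lambda>i. Z (N + i)) b"
  by unfold_locales (auto intro: indep_vars_shift indep_Z bounded_Z simp: mean_Z)

definition var :: "nat \<Rightarrow> real" where
  "var i = expectation (\<lambda>\<omega>. (Z i \<omega>)\<^sup>2)"

lemma var_nonneg: "0 \<le> var i"
  unfolding var_def by (intro integral_nonneg_AE) auto

text \<open>Each step adds the increment times the indicator of not having left the interval. The
  cross term vanishes because \<open>Z n\<close> is centred and independent of the past, and the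
  square term factors for the same independence.\<close>

lemma second_moment_stopped_sum:
  assumes "0 \<le> c"
  shows "expectation (\<lambda>\<omega>. (stopped_sum c (\<lambda>i. Z i \<omega>) n)\<^sup>2) =
    (\<Sum>i<n. prob {\<omega> \<in> space M. contained c (\<lambda>i. Z i \<omega>) i} * var i)"
proof (induction n)
  case 0
  then show ?case by (simp add: stopped_sum_def)
next
  case (Suc n)
  define U where "U f = stopped_sum c f n" for f
  define I where "I f = (if contained c f n then 1 else 0 :: real)" for f
  have [measurable]: "U \<in> borel_measurable real_seq" "I \<in> borel_measurable real_seq"
    unfolding U_def I_def by measurable
  have [measurable]: "(\<lambda>\<omega>. U (\<lambda>i. Z i \<omega>)) \<in> borel_measurable M" "(\<lambda>\<omega>. I (\<lambda>i. Z i \<omega>)) \<in> borel_measurable M"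
    by measurable
  have I: "\<bar>I f\<bar> \<le> 1" for f by (simp add: I_def)
  have U: "\<bar>U (\<lambda>i. Z i \<omega>)\<bar> \<le> c + b" for \<omega>
    unfolding U_def by (intro abs_stopped_sum_le assms bounded_Z)
  have UI: "\<bar>U (\<lambda>i. Z i \<omega>) * I (\<lambda>i. Z i \<omega>)\<bar> \<le> c + b" for \<omega>
    using mult_mono[OF U[of \<omega>] I[of "\<lambda>i. Z i \<omega>"]] U[of \<omega>] by (simp add: abs_mult)
  have b0: "0 \<le> b" using bounded_Z[of 0] by (meson abs_ge_zero order_trans)
  have Z2: "(Z n \<omega>)\<^sup>2 \<le> b\<^sup>2" for \<omega> using bounded_Z[of n \<omega>] by (simp add: abs_le_square_iff[symmetric] b0)
  have int_Z: "integrable M (Z n)" by (rule integrable_const_bound[where B = b]) (auto simp: bounded_Z)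
  have int_Z2: "integrable M (\<lambda>\<omega>. (Z n \<omega>)\<^sup>2)"
    by (rule integrable_const_bound[where B = "b\<^sup>2"]) (auto simp: Z2)
  have int_I: "integrable M (\<lambda>\<omega>. I (\<lambda>i. Z i \<omega>))"
    by (rule integrable_const_bound[where B = 1]) (auto simp: I)
  have int_UI: "integrable M (\<lambda>\<omega>. U (\<lambda>i. Z i \<omega>) * I (\<lambda>i. Z i \<omega>))"
    by (rule integrable_const_bound[where B = "c + b"]) (auto simp: UI)
  have int_U2: "integrable M (\<lambda>\<omega>. (U (\<lambda>i. Z i \<omega>))\<^sup>2)"
  proof (rule integrable_const_bound[where B = "(c + b)\<^sup>2"])
    show "AE \<omega> in M. norm ((U (\<lambda>i. Z i \<omega>))\<^sup>2) \<le> (c + b)\<^sup>2"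
      using U assms b0 by (intro AE_I2) (simp add: abs_le_square_iff[symmetric])
  qed measurable
  have cong: "U (\<lambda>i. if i < n then f i else 0) = U f" "I (\<lambda>i. if i < n then f i else 0) = I f" for f
  proof -
    show "U (\<lambda>i. if i < n then f i else 0) = U f" unfolding U_def by (rule stopped_sum_cong) simp
    have "contained c (\<lambda>i. if i < n then f i else 0) n \<longleftrightarrow> contained c f n"
      by (rule contained_cong) simp
    then show "I (\<lambda>i. if i < n then f i else 0) = I f" unfolding I_def by simp
  qed
  have ind1: "indep_var borel (\<lambda>\<omega>. U (\<lambda>i. Z i \<omega>) * I (\<lambda>i. Z i \<omega>)) borel (Z n)"
    using indep_past[OF indep_Z, of "\<lambda>f. U f * I f" n] cong by simp
  have "indep_var borel (\<lambda>\<omega>. I (\<lambda>i. Z i \<omega>)) borel (Z n)"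
    using indep_past[OF indep_Z, of I n] cong by simp
  from indep_var_compose[OF this, of "\<lambda>x. x" borel "\<lambda>x. x\<^sup>2" borel]
  have ind2: "indep_var borel (\<lambda>\<omega>. I (\<lambda>i. Z i \<omega>)) borel (\<lambda>\<omega>. (Z n \<omega>)\<^sup>2)" by (simp add: comp_def)
  have "(stopped_sum c f (Suc n))\<^sup>2 = (U f)\<^sup>2 + 2 * ((U f * I f) * f n) + I f * (f n)\<^sup>2" for f
    by (simp add: stopped_sum_def U_def I_def power2_sum)
  then have "expectation (\<lambda>\<omega>. (stopped_sum c (\<lambda>i. Z i \<omega>) (Suc n))\<^sup>2) =
    expectation (\<lambda>\<omega>. (U (\<lambda>i. Z i \<omega>))\<^sup>2 + 2 * ((U (\<lambda>i. Z i \<omega>) * I (\<lambda>i. Z i \<omega>)) * Z n \<omega>) +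
      I (\<lambda>i. Z i \<omega>) * (Z n \<omega>)\<^sup>2)" by simp
  also have "\<dots> = expectation (\<lambda>\<omega>. (U (\<lambda>i. Z i \<omega>))\<^sup>2) +
      2 * expectation (\<lambda>\<omega>. (U (\<lambda>i. Z i \<omega>) * I (\<lambda>i. Z i \<omega>)) * Z n \<omega>) +
      expectation (\<lambda>\<omega>. I (\<lambda>i. Z i \<omega>) * (Z n \<omega>)\<^sup>2)"
    using int_U2 indep_var_integrable[OF ind1 int_UI int_Z] indep_var_integrable[OF ind2 int_I int_Z2]
    by simp
  also have "expectation (\<lambda>\<omega>. (U (\<lambda>i. Z i \<omega>) * I (\<lambda>i. Z i \<omega>)) * Z n \<omega>) = 0"
    using indep_var_lebesgue_integral[OF ind1 int_UI int_Z] mean_Z by simp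
  also have "expectation (\<lambda>\<omega>. I (\<lambda>i. Z i \<omega>) * (Z n \<omega>)\<^sup>2) = expectation (\<lambda>\<omega>. I (\<lambda>i. Z i \<omega>)) * var n"
    unfolding var_def by (rule indep_var_lebesgue_integral[OF ind2 int_I int_Z2])
  also have "expectation (\<lambda>\<omega>. I (\<lambda>i. Z i \<omega>)) =
      expectation (indicator {\<omega> \<in> space M. contained c (\<lambda>i. Z i \<omega>) n})"
    by (intro Bochner_Integration.integral_cong) (auto simp: I_def indicator_def)
  also have "\<dots> = prob {\<omega> \<in> space M. contained c (\<lambda>i. Z i \<omega>) n}" by simp
  finally show ?case using Suc unfolding U_def by simp
qed

text \<open>Kolmogorov's maximal inequality. The stopped sum exceeds \<open>c\<close> in absolute
  value after an exit, so Chebyshev's inequality applies to its second moment, whose weights are at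
  most 1.\<close>

lemma prob_not_contained_le:
  assumes "0 < c"
  shows "prob {\<omega> \<in> space M. \<not> contained c (\<lambda>i. Z i \<omega>) n} \<le> (\<Sum>i<n. var i) / c\<^sup>2"
proof -
  let ?U = "\<lambda>\<omega>. stopped_sum c (\<lambda>i. Z i \<omega>) n"
  let ?B = "{\<omega> \<in> space M. \<not> contained c (\<lambda>i. Z i \<omega>) n}"
  have U: "\<bar>?U \<omega>\<bar> \<le> c + b" for \<omega> using assms by (intro abs_stopped_sum_le bounded_Z) simp
  have "prob ?B * c\<^sup>2 = expectation (\<lambda>\<omega>. indicator ?B \<omega> * c\<^sup>2)" by simp
  also have "\<dots> \<le> expectation (\<lambda>\<omega>. (?U \<omega>)\<^sup>2)"
  proof (rule integral_mono)
    show "integrable M (\<lambda>\<omega>. indicator ?B \<omega> * c\<^sup>2)"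
      by (rule integrable_const_bound[where B = "c\<^sup>2"]) (auto simp: indicator_def)
    show "integrable M (\<lambda>\<omega>. (?U \<omega>)\<^sup>2)"
    proof (rule integrable_const_bound[where B = "(c + b)\<^sup>2"])
      have "norm ((?U \<omega>)\<^sup>2) \<le> (c + b)\<^sup>2" for \<omega>
        using power_mono[OF U[of \<omega>], of 2] by simp
      then show "AE \<omega> in M. norm ((?U \<omega>)\<^sup>2) \<le> (c + b)\<^sup>2" by simp
    qed measurable
    fix \<omega>
    show "indicator ?B \<omega> * c\<^sup>2 \<le> (?U \<omega>)\<^sup>2"
    proof (cases "\<omega> \<in> ?B")
      case True
      then have "c < \<bar>?U \<omega>\<bar>"
        using stopped_sum_cases[of c "\<lambda>i. Z i \<omega>" b n] assms bounded_Z by auto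
      then have "c\<^sup>2 \<le> (?U \<omega>)\<^sup>2" using power_mono[of c "\<bar>?U \<omega>\<bar>" 2] assms by simp
      then show ?thesis using True by simp
    qed simp
  qed
  also have "\<dots> = (\<Sum>i<n. prob {\<omega> \<in> space M. contained c (\<lambda>i. Z i \<omega>) i} * var i)"
    using assms by (intro second_moment_stopped_sum) simp
  also have "\<dots> \<le> (\<Sum>i<n. 1 * var i)" by (intro sum_mono mult_right_mono var_nonneg) auto
  finally show ?thesis using assms by (simp add: field_simps)
qed

text \<open>The same second moment read in the other direction: all weights are at least the
  probability of never leaving, while the stopped sum is bounded by \<open>c + b\<close>.\<close>

lemma summable_var:
  assumes "0 \<le> c" and pos: "0 < prob {\<omega> \<in> space M. \<forall>n. \<bar>psum (\<lambda>i. Z i \<omega>) n\<bar> \<le> c}"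
  shows "summable var"
proof (rule bounded_imp_summable)
  let ?p = "prob {\<omega> \<in> space M. \<forall>n. \<bar>psum (\<lambda>i. Z i \<omega>) n\<bar> \<le> c}"
  show "0 \<le> var i" for i by (rule var_nonneg)
  show "(\<Sum>i\<le>n. var i) \<le> (c + b)\<^sup>2 / ?p" for n
  proof -
    have "?p * (\<Sum>i\<le>n. var i) = (\<Sum>i<Suc n. ?p * var i)"
      by (simp add: sum_distrib_left lessThan_Suc_atMost)
    also have "\<dots> \<le> (\<Sum>i<Suc n. prob {\<omega> \<in> space M. contained c (\<lambda>i. Z i \<omega>) i} * var i)"
      by (intro sum_mono mult_right_mono var_nonneg finite_measure_mono) (auto simp: contained_def)
    also have "\<dots> = expectation (\<lambda>\<omega>. (stopped_sum c (\<lambda>i. Z i \<omega>) (Suc n))\<^sup>2)"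
      using second_moment_stopped_sum[OF assms(1), of "Suc n"] by simp
    also have "\<dots> \<le> expectation (\<lambda>\<omega>. (c + b)\<^sup>2)"
    proof (rule integral_mono')
      show "(stopped_sum c (\<lambda>i. Z i \<omega>) (Suc n))\<^sup>2 \<le> (c + b)\<^sup>2" for \<omega>
      proof -
        have "\<bar>stopped_sum c (\<lambda>i. Z i \<omega>) (Suc n)\<bar> \<le> c + b"
          by (intro abs_stopped_sum_le assms(1) bounded_Z)
        from power_mono[OF this, of 2] show ?thesis by simp
      qed
    qed auto
    finally show ?thesis using pos by (simp add: field_simps prob_space)
  qed
qed

text \<open>The maximal inequality for the sequence shifted by \<open>N\<close> bounds the
  oscillation after \<open>N\<close> by a remainder of the variance series, which tends to 0. The
  partial sums are therefore almost surely Cauchy.\<close>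

lemma AE_summable:
  assumes "summable var"
  shows "AE \<omega> in M. summable (\<lambda>i. Z i \<omega>)"
proof -
  have small: "AE \<omega> in M. \<exists>N. \<forall>k. \<bar>psum (\<lambda>i. Z (N + i) \<omega>) k\<bar> \<le> e" if e: "0 < e" for e :: real
  proof -
    define B where "B N = {\<omega> \<in> space M. \<exists>n. \<not> contained e (\<lambda>i. Z (N + i) \<omega>) n}" for N
    define B' where "B' N n = {\<omega> \<in> space M. \<not> contained e (\<lambda>i. Z (N + i) \<omega>) n}" for N n
    have seq [measurable]: "(\<lambda>\<omega> i. Z (N + i) \<omega>) \<in> measurable M real_seq" for N
      by (intro measurable_seq Z_measurable)
    have [measurable]: "B N \<in> sets M" "B' N n \<in> sets M" for N n unfolding B_def B'_def by measurable
    define r where "r N = (\<Sum>i. var (i + N))" for N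
    have "prob (B N) \<le> r N / e\<^sup>2" for N
    proof -
      interpret S: bounded_centered M "\<lambda>i. Z (N + i)" b by (rule bounded_centered_shift)
      have "(\<lambda>n. prob (B' N n)) \<longlonglongrightarrow> prob (\<Union>n. B' N n)"
        by (intro finite_Lim_measure_incseq) (auto simp: incseq_def B'_def dest: contained_antimono)
      moreover have "(\<Union>n. B' N n) = B N" unfolding B_def B'_def by auto
      moreover have "prob (B' N n) \<le> r N / e\<^sup>2" for n
      proof -
        have "prob (B' N n) \<le> (\<Sum>i<n. S.var i) / e\<^sup>2"
          unfolding B'_def by (rule S.prob_not_contained_le[OF e])
        also have "(\<Sum>i<n. S.var i) = (\<Sum>i<n. var (i + N))"
          unfolding S.var_def var_def by (simp add: add.commute)
        also have "\<dots> \<le> r N" unfolding r_def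
          using assms var_nonneg by (intro sum_le_suminf) (auto simp: summable_iff_shift)
        finally show ?thesis by (simp add: divide_right_mono)
      qed
      ultimately show ?thesis by (auto intro: LIMSEQ_le_const2)
    qed
    moreover have "(\<lambda>N. r N / e\<^sup>2) \<longlonglongrightarrow> 0 / e\<^sup>2"
      unfolding r_def by (intro tendsto_divide suminf_exist_split2 assms) (use e in auto)
    \<comment> \<open>The outcomes that oscillate by more than \<open>e\<close> after every
      \<open>N\<close> lie in each \<open>B N\<close>.\<close>
    moreover have "prob (\<Inter>N. B N) \<le> prob (B N)" for N by (intro finite_measure_mono) auto
    ultimately have "prob (\<Inter>N. B N) \<le> 0"
      by (intro LIMSEQ_le_const[of "\<lambda>N. r N / e\<^sup>2"]) (auto intro: order_trans)
    then have "prob (\<Inter>N. B N) = 0" by (simp add: measure_le_0_iff)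
    then have "AE \<omega> in M. \<omega> \<notin> (\<Inter>N. B N)" by (simp add: prob_eq_0)
    then show ?thesis using AE_space
      by eventually_elim (auto simp: B_def contained_def)
  qed
  have "AE \<omega> in M. \<forall>j::nat. \<exists>N. \<forall>k. \<bar>psum (\<lambda>i. Z (N + i) \<omega>) k\<bar> \<le> 1 / Suc j"
    unfolding AE_all_countable by (intro allI small) simp
  then show ?thesis
  proof eventually_elim
    fix \<omega> assume *: "\<forall>j::nat. \<exists>N. \<forall>k. \<bar>psum (\<lambda>i. Z (N + i) \<omega>) k\<bar> \<le> 1 / Suc j"
    show "summable (\<lambda>i. Z i \<omega>)"
      unfolding summable_Cauchy
    proof (intro allI impI)
      fix e :: real assume "0 < e"
      then obtain j where j: "1 / Suc j < e / 2" using nat_approx_posE[of "e / 2"] by auto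
      obtain N where N: "\<And>k. \<bar>psum (\<lambda>i. Z (N + i) \<omega>) k\<bar> \<le> 1 / Suc j" using * by blast
      have ps: "psum (\<lambda>i. Z (N + i) \<omega>) k = (\<Sum>i\<in>{N..<N + k}. Z i \<omega>)" for k
        unfolding psum_def using sum.shift_bounds_nat_ivl[of "\<lambda>i. Z i \<omega>" 0 N k]
        by (simp add: atLeast0LessThan add.commute)
      have "norm (\<Sum>i\<in>{m..<n}. Z i \<omega>) < e" if "m \<ge> N" for m n
      proof (cases "m \<le> n")
        case True
        have "(\<Sum>i\<in>{N..<m}. Z i \<omega>) + (\<Sum>i\<in>{m..<n}. Z i \<omega>) = (\<Sum>i\<in>{N..<n}. Z i \<omega>)"
          using True that by (intro sum.atLeastLessThan_concat) auto
        then have "(\<Sum>i\<in>{m..<n}. Z i \<omega>) =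
            psum (\<lambda>i. Z (N + i) \<omega>) (n - N) - psum (\<lambda>i. Z (N + i) \<omega>) (m - N)"
          using ps[of "n - N"] ps[of "m - N"] True that by simp
        moreover have "\<bar>u - v\<bar> < e" if "\<bar>u\<bar> \<le> 1 / Suc j" "\<bar>v\<bar> \<le> 1 / Suc j" for u v :: real
          using that j by linarith
        ultimately show ?thesis using N[of "n - N"] N[of "m - N"] by simp
      next
        case False
        then show ?thesis using \<open>0 < e\<close> by simp
      qed
      then show "\<exists>N. \<forall>m\<ge>N. \<forall>n. norm (\<Sum>i\<in>{m..<n}. Z i \<omega>) < e" by blast
    qed
  qed
qed

end

section \<open>Convergence of symmetric series with partial sums bounded below\<close>

lemma summable_tail_iff:
  fixes f :: "nat \<Rightarrow> real"
  shows "summable (\<lambda>i. if i < N then 0 else f i) \<longleftrightarrow> summable f"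
  by (intro summable_cong) (auto simp: eventually_sequentially intro: exI[of _ N])

text \<open>The hypothesis \<open>bounded\<close> only denies an almost sure statement, so it gives
  a lower bound with positive probability, which the 0-1 law makes almost sure. The second moment
  argument again yields convergence on a set of positive probability only, and the 0-1 law is used
  once more.\<close>

lemma (in prob_space) AE_symmetric_summable:
  fixes X :: "nat \<Rightarrow> 'a \<Rightarrow> real"
  assumes indep: "indep_vars (\<lambda>_. borel) X UNIV"
    and sym: "\<And>i. distr M borel (\<lambda>\<omega>. - X i \<omega>) = distr M borel (X i)"
    and bounded: "\<not> (AE \<omega> in M. \<forall>c. \<exists>n. psum (\<lambda>i. X i \<omega>) n < c)"
  shows "AE \<omega> in M. summable (\<lambda>i. X i \<omega>)"
proof -
  have X [measurable]: "\<And>i. X i \<in> borel_measurable M"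
    using indep by (auto simp: indep_vars_def)
  note Xseq [measurable] = measurable_seq[of X M, OF X]
  \<comment> \<open>Natural numbers as bounds keep the quantifier countable, hence \<open>Q\<close>
    measurable.\<close>
  define Q where "Q f \<longleftrightarrow> (\<exists>c::nat. \<forall>n. - real c \<le> psum f n)" for f
  have Q_iff: "Q f \<longleftrightarrow> (\<exists>c. \<forall>n. c \<le> psum f n)" for f
  proof
    assume "\<exists>c. \<forall>n. c \<le> psum f n"
    then obtain c where c: "\<And>n. c \<le> psum f n" by blast
    obtain k :: nat where "- c \<le> k" using real_arch_simple by blast
    then have "- real k \<le> psum f n" for n using c[of n] by linarith
    then show "Q f" unfolding Q_def by blast
  qed (auto simp: Q_def)
  have Q_mono: "Q g" if "Q f" "\<And>n. psum f n - d \<le> psum g n" for f g d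
  proof -
    obtain c where c: "\<And>n. c \<le> psum f n" using \<open>Q f\<close> unfolding Q_iff by blast
    then have "c - d \<le> psum g n" for n using that(2)[of n] c[of n] by linarith
    then show ?thesis unfolding Q_iff by blast
  qed
  have [measurable]: "Measurable.pred real_seq Q" unfolding Q_def by measurable
  \<comment> \<open>Erasing the first \<open>N\<close> entries moves every partial sum by at most
    the fixed amount given by their absolute values.\<close>
  have "Q (\<lambda>i. if i < N then 0 else f i) \<longleftrightarrow> Q f" for N f
  proof -
    have "\<bar>psum (\<lambda>i. if i < N then 0 else f i) n - psum f n\<bar> \<le> (\<Sum>i<N. \<bar>f i\<bar>)" for n
    proof -
      have "\<bar>psum (\<lambda>i. if i < N then 0 else f i) n - psum f n\<bar> = \<bar>\<Sum>i<n. if i < N then - f i else 0\<bar>"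
        unfolding psum_def sum_subtractf[symmetric] by (intro arg_cong[where f = abs] sum.cong) auto
      also have "\<dots> \<le> (\<Sum>i<n. \<bar>if i < N then - f i else 0\<bar>)" by (rule sum_abs)
      also have "\<dots> = (\<Sum>i\<in>{..<n} \<inter> {..<N}. \<bar>f i\<bar>)"
        by (intro sum.mono_neutral_cong_right) auto
      also have "\<dots> \<le> (\<Sum>i<N. \<bar>f i\<bar>)" by (intro sum_mono2) auto
      finally show ?thesis .
    qed
    then have "psum f n - (\<Sum>i<N. \<bar>f i\<bar>) \<le> psum (\<lambda>i. if i < N then 0 else f i) n"
        "psum (\<lambda>i. if i < N then 0 else f i) n - (\<Sum>i<N. \<bar>f i\<bar>) \<le> psum f n" for n
      by (simp_all add: abs_le_iff algebra_simps)
    then show ?thesis using Q_mono by blast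
  qed
  then have "(AE \<omega> in M. Q (\<lambda>i. X i \<omega>)) \<or> (AE \<omega> in M. \<not> Q (\<lambda>i. X i \<omega>))"
    by (intro zero_one_law_seq indep) auto
  moreover have "(\<forall>c. \<exists>n. psum f n < c) \<longleftrightarrow> \<not> Q f" for f unfolding Q_iff by (simp add: not_le)
  ultimately have below: "AE \<omega> in M. Q (\<lambda>i. X i \<omega>)" using bounded by simp
  then have "AE f in distr M real_seq (\<lambda>\<omega> i. X i \<omega>). Q f" by (subst AE_distr_iff) auto
  \<comment> \<open>All signs are flipped at once, which turns the lower bound into an upper
    one.\<close>
  moreover have "distr M real_seq (\<lambda>\<omega> i. - X i \<omega>) = distr M real_seq (\<lambda>\<omega> i. X i \<omega>)"
    using distr_flip[OF indep, of UNIV] sym by simp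
  ultimately have "AE f in distr M real_seq (\<lambda>\<omega> i. - X i \<omega>). Q f"
    by (simp only:)
  then have above: "AE \<omega> in M. Q (\<lambda>i. - X i \<omega>)"
    by (subst (asm) AE_distr_iff) (auto intro!: measurable_seq)
  have bounded_AE: "AE \<omega> in M. \<exists>c::nat. \<forall>n. \<bar>psum (\<lambda>i. X i \<omega>) n\<bar> \<le> c"
    using below above
  proof eventually_elim
    case (elim \<omega>)
    obtain c d :: nat where "\<And>n. - real c \<le> psum (\<lambda>i. X i \<omega>) n" "\<And>n. - real d \<le> psum (\<lambda>i. - X i \<omega>) n"
      using elim unfolding Q_def by blast
    moreover have "psum (\<lambda>i. - X i \<omega>) n = - psum (\<lambda>i. X i \<omega>) n" for n
      by (simp add: psum_def sum_negf)
    ultimately have "\<bar>psum (\<lambda>i. X i \<omega>) n\<bar> \<le> real (c + d)" for n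
      by (smt (verit) of_nat_0_le_iff of_nat_add)
    then show ?case by blast
  qed
  \<comment> \<open>Countably many bounds exhaust an almost sure event, so one of them holds with
    positive probability.\<close>
  have "\<not> (AE \<omega> in M. \<forall>c::nat. \<not> (\<forall>n. \<bar>psum (\<lambda>i. X i \<omega>) n\<bar> \<le> c))"
  proof
    assume "AE \<omega> in M. \<forall>c::nat. \<not> (\<forall>n. \<bar>psum (\<lambda>i. X i \<omega>) n\<bar> \<le> c)"
    with bounded_AE have "AE \<omega> in M. False" by eventually_elim blast
    then show False by simp
  qed
  then obtain c :: nat where c: "\<not> (AE \<omega> in M. \<not> (\<forall>n. \<bar>psum (\<lambda>i. X i \<omega>) n\<bar> \<le> c))"
    unfolding AE_all_countable by blast
  define B where "B = {\<omega> \<in> space M. \<forall>n. \<bar>psum (\<lambda>i. X i \<omega>) n\<bar> \<le> c}"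
  have [measurable]: "B \<in> sets M" unfolding B_def by measurable
  have B: "\<not> (AE \<omega> in M. \<omega> \<notin> B)"
  proof
    assume "AE \<omega> in M. \<omega> \<notin> B"
    then have "AE \<omega> in M. \<not> (\<forall>n. \<bar>psum (\<lambda>i. X i \<omega>) n\<bar> \<le> c)"
      using AE_space by eventually_elim (auto simp: B_def)
    then show False using c by blast
  qed
  \<comment> \<open>On \<open>B\<close> the increments are at most \<open>2 * c\<close>, so this truncation does not change the series there.\<close>
  define h where "h x = (if \<bar>x\<bar> \<le> 2 * c then x else 0)" for x :: real
  have [measurable]: "h \<in> borel_measurable borel" unfolding h_def by measurable
  interpret Z: bounded_centered M "\<lambda>i \<omega>. h (X i \<omega>)" "2 * c"
  proof
    show "indep_vars (\<lambda>_. borel) (\<lambda>i \<omega>. h (X i \<omega>)) UNIV" by (rule indep_vars_compose2[OF indep]) auto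
    show "\<bar>h (X i \<omega>)\<bar> \<le> 2 * c" for i \<omega> unfolding h_def by auto
    show "expectation (\<lambda>\<omega>. h (X i \<omega>)) = 0" for i
    proof -
      have "expectation (\<lambda>\<omega>. h (X i \<omega>)) = integral\<^sup>L (distr M borel (X i)) h"
        by (simp add: integral_distr)
      also have "\<dots> = integral\<^sup>L (distr M borel (\<lambda>\<omega>. - X i \<omega>)) h" by (simp add: sym)
      also have "\<dots> = expectation (\<lambda>\<omega>. h (- X i \<omega>))" by (simp add: integral_distr)
      \<comment> \<open>\<open>h\<close> is odd, so by symmetry the mean equals its own
        negative.\<close>
      also have "\<dots> = expectation (\<lambda>\<omega>. - h (X i \<omega>))"
        by (intro Bochner_Integration.integral_cong) (auto simp: h_def)
      finally show ?thesis by simp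
    qed
  qed
  have hX: "h (X i \<omega>) = X i \<omega>" if "\<omega> \<in> B" for i \<omega>
  proof -
    have "X i \<omega> = psum (\<lambda>i. X i \<omega>) (Suc i) - psum (\<lambda>i. X i \<omega>) i" by (simp add: psum_def)
    moreover have "\<bar>psum (\<lambda>i. X i \<omega>) (Suc i)\<bar> \<le> c" "\<bar>psum (\<lambda>i. X i \<omega>) i\<bar> \<le> c"
      using that unfolding B_def by auto
    ultimately show ?thesis unfolding h_def by (auto simp: abs_le_iff)
  qed
  have "0 < prob B" using B by (simp add: prob_eq_0 zero_less_measure_iff)
  also have "prob B \<le> prob {\<omega> \<in> space M. \<forall>n. \<bar>psum (\<lambda>i. h (X i \<omega>)) n\<bar> \<le> c}"
  proof (rule finite_measure_mono)
    show "B \<subseteq> {\<omega> \<in> space M. \<forall>n. \<bar>psum (\<lambda>i. h (X i \<omega>)) n\<bar> \<le> c}"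
      using hX by (auto simp: B_def)
    show "{\<omega> \<in> space M. \<forall>n. \<bar>psum (\<lambda>i. h (X i \<omega>)) n\<bar> \<le> real c} \<in> events"
      using Z.Z_seq_measurable by measurable
  qed
  finally have "AE \<omega> in M. summable (\<lambda>i. h (X i \<omega>))"
    by (intro Z.AE_summable Z.summable_var[of "real c"]) auto
  then have on_B: "AE \<omega> in M. \<omega> \<in> B \<longrightarrow> summable (\<lambda>i. X i \<omega>)"
    by eventually_elim (auto simp: hX)
  have "\<not> (AE \<omega> in M. \<not> summable (\<lambda>i. X i \<omega>))"
  proof
    assume "AE \<omega> in M. \<not> summable (\<lambda>i. X i \<omega>)"
    with on_B have "AE \<omega> in M. \<omega> \<notin> B" by eventually_elim blast
    then show False using B by blast
  qed
  moreover have "(AE \<omega> in M. summable (\<lambda>i. X i \<omega>)) \<or> (AE \<omega> in M. \<not> summable (\<lambda>i. X i \<omega>))"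
    by (intro zero_one_law_seq indep summable_tail_iff) measurable
  ultimately show ?thesis by blast
qed

section \<open>Coincidences of independent random variables\<close>

text \<open>Fubini: for every fixed value of \<open>V\<close>, the variable \<open>U\<close> avoids
  it almost surely.\<close>

lemma (in prob_space) AE_indep_neq:
  fixes U V :: "'a \<Rightarrow> real"
  assumes indep: "indep_var borel V borel U"
    and no_atom: "\<And>x. measure (distr M borel U) {x} = 0"
  shows "AE \<omega> in M. U \<omega> \<noteq> V \<omega>"
proof -
  have [measurable]: "U \<in> borel_measurable M" "V \<in> borel_measurable M"
    using indep by (auto dest: indep_var_rv1 indep_var_rv2)
  interpret U: prob_space "distr M borel U" by (rule prob_space_distr) simp
  interpret V: prob_space "distr M borel V" by (rule prob_space_distr) simp
  interpret VU: pair_prob_space "distr M borel V" "distr M borel U" ..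
  have "AE u in distr M borel U. u \<noteq> v" for v
    using no_atom[of v] AE_not_in[of "{v}" "distr M borel U"]
    by (simp add: null_sets_def U.emeasure_eq_measure)
  then have "AE v in distr M borel V. AE u in distr M borel U. (\<lambda>(v, u). u \<noteq> v) (v, u)" by simp
  then have "AE p in distr M borel V \<Otimes>\<^sub>M distr M borel U. (\<lambda>(v, u). u \<noteq> v) p"
    by (intro VU.AE_pair_measure) measurable
  moreover have "distr M borel V \<Otimes>\<^sub>M distr M borel U = distr M (borel \<Otimes>\<^sub>M borel) (\<lambda>\<omega>. (V \<omega>, U \<omega>))"
    using indep by (simp add: indep_var_distribution_eq)
  ultimately have "AE p in distr M (borel \<Otimes>\<^sub>M borel) (\<lambda>\<omega>. (V \<omega>, U \<omega>)). (\<lambda>(v, u). u \<noteq> v) p"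
    by (simp only:)
  then show ?thesis by (subst (asm) AE_distr_iff) auto
qed

text \<open>By Fubini \<open>P(U \<noteq> V)\<close> is the mean of \<open>P(V \<noteq> u)\<close>
  over \<open>u\<close> distributed as \<open>U\<close>, and some nonnegative \<open>u\<close> does
  not exceed the mean. This supplies the constants at which criterion (b) for monopoly is
  tested.\<close>

lemma (in prob_space) ex_dominant_value:
  fixes U V :: "'a \<Rightarrow> real"
  assumes indep: "indep_var borel U borel V"
    and nonneg: "AE \<omega> in M. 0 \<le> U \<omega>"
  shows "\<exists>c\<ge>0. emeasure M {\<omega> \<in> space M. V \<omega> \<noteq> c} \<le> emeasure M {\<omega> \<in> space M. U \<omega> \<noteq> V \<omega>}"
proof (rule ccontr)
  assume *: "\<not> ?thesis"
  have [measurable]: "U \<in> borel_measurable M" "V \<in> borel_measurable M"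
    using indep by (auto dest: indep_var_rv1 indep_var_rv2)
  define p where "p = emeasure M {\<omega> \<in> space M. U \<omega> \<noteq> V \<omega>}"
  let ?U = "distr M borel U" and ?V = "distr M borel V"
  interpret U: prob_space ?U by (rule prob_space_distr) simp
  interpret V: prob_space ?V by (rule prob_space_distr) simp
  define D where "D = {q \<in> space (borel \<Otimes>\<^sub>M borel). fst q \<noteq> (snd q :: real)}"
  have D [measurable]: "D \<in> sets (borel \<Otimes>\<^sub>M borel)"
    unfolding D_def by measurable
  have D' [measurable]: "D \<in> sets (?U \<Otimes>\<^sub>M ?V)" by simp
  have "p = emeasure (distr M (borel \<Otimes>\<^sub>M borel) (\<lambda>\<omega>. (U \<omega>, V \<omega>))) D"
    unfolding p_def by (subst emeasure_distr[OF _ D]) (auto simp: D_def space_pair_measure intro!: arg_cong[where f = "emeasure M"])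
  also have "\<dots> = emeasure (?U \<Otimes>\<^sub>M ?V) D"
    using indep by (simp add: indep_var_distribution_eq)
  also have "\<dots> = (\<integral>\<^sup>+u. emeasure ?V (Pair u -` D) \<partial>?U)"
    by (rule V.emeasure_pair_measure_alt) simp
  finally have p: "p = (\<integral>\<^sup>+u. emeasure ?V (Pair u -` D) \<partial>?U)" .
  have slice: "emeasure ?V (Pair u -` D) = emeasure M {\<omega> \<in> space M. V \<omega> \<noteq> u}" for u
  proof -
    have "Pair u -` D = - {u}" by (auto simp: D_def space_pair_measure)
    then show ?thesis by (subst emeasure_distr) (auto intro!: arg_cong[where f = "emeasure M"])
  qed
  have less: "p < emeasure M {\<omega> \<in> space M. V \<omega> \<noteq> u}" if "0 \<le> u" for u
    using * that unfolding p_def by (meson not_le)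
  have "AE u in ?U. 0 \<le> u" using nonneg by (subst AE_distr_iff) auto
  then have AE: "AE u in ?U. p < emeasure ?V (Pair u -` D)"
    by eventually_elim (simp add: less slice)
  have "(\<integral>\<^sup>+u. p \<partial>?U) < (\<integral>\<^sup>+u. emeasure ?V (Pair u -` D) \<partial>?U)"
  proof (rule nn_integral_less)
    show "(\<lambda>u. emeasure ?V (Pair u -` D)) \<in> borel_measurable ?U"
      by (rule V.measurable_emeasure_Pair) simp
    show "AE u in ?U. p \<le> emeasure ?V (Pair u -` D)" using AE by eventually_elim auto
    show "\<not> (AE u in ?U. emeasure ?V (Pair u -` D) \<le> p)"
    proof
      assume "AE u in ?U. emeasure ?V (Pair u -` D) \<le> p"
      with AE have "AE u in ?U. False" by eventually_elim auto
      then show False by simp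
    qed
    show "(\<integral>\<^sup>+u. p \<partial>?U) \<noteq> \<infinity>"
      using emeasure_finite by (simp add: p_def U.emeasure_space_1[simplified])
  qed simp
  then show False using p U.emeasure_space_1 by simp
qed

text \<open>The second Borel-Cantelli lemma, contraposed. Some \<open>n\<close> has positive
  probability that all entries from \<open>n\<close> on vanish; by independence and
  \<open>1 - p \<le> exp (- p)\<close> the logarithm of this probability bounds the sum of the
  \<open>p i\<close>.\<close>

lemma (in prob_space) summable_prob_nonzero:
  fixes X :: "nat \<Rightarrow> 'a \<Rightarrow> real"
  assumes indep: "indep_vars (\<lambda>_. borel) X UNIV"
    and zero: "AE \<omega> in M. eventually (\<lambda>i. X i \<omega> = 0) sequentially"
  shows "summable (\<lambda>i. prob {\<omega> \<in> space M. X i \<omega> \<noteq> 0})"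
proof -
  have X [measurable]: "\<And>i. X i \<in> borel_measurable M"
    using indep by (auto simp: indep_vars_def)
  define p where "p i = prob {\<omega> \<in> space M. X i \<omega> \<noteq> 0}" for i
  have "\<not> (AE \<omega> in M. \<forall>n. \<not> (\<forall>i\<ge>n. X i \<omega> = 0))"
  proof
    assume "AE \<omega> in M. \<forall>n. \<not> (\<forall>i\<ge>n. X i \<omega> = 0)"
    with zero have "AE \<omega> in M. False" by eventually_elim (auto simp: eventually_sequentially)
    then show False by simp
  qed
  then obtain n where n: "\<not> (AE \<omega> in M. \<not> (\<forall>i\<ge>n. X i \<omega> = 0))"
    unfolding AE_all_countable by blast
  define B where "B = {\<omega> \<in> space M. \<forall>i\<ge>n. X i \<omega> = 0}"
  have [measurable]: "B \<in> sets M" unfolding B_def by measurable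
  have "\<not> (AE \<omega> in M. \<omega> \<notin> B)"
  proof
    assume "AE \<omega> in M. \<omega> \<notin> B"
    then have "AE \<omega> in M. \<not> (\<forall>i\<ge>n. X i \<omega> = 0)"
      using AE_space by eventually_elim (auto simp: B_def)
    then show False using n by blast
  qed
  then have q: "0 < prob B" by (simp add: prob_eq_0 zero_less_measure_iff)
  have bound: "(\<Sum>i\<le>k. p (i + n)) \<le> - ln (prob B)" for k
  proof -
    have "prob B \<le> prob (\<Inter>i\<in>{n..n + k}. X i -` {0} \<inter> space M)"
      by (intro finite_measure_mono) (auto simp: B_def)
    also have "\<dots> = (\<Prod>i\<in>{n..n + k}. prob (X i -` {0} \<inter> space M))"
      by (intro indep_varsD[OF indep]) auto
    also have "\<dots> = (\<Prod>i\<in>{n..n + k}. 1 - p i)"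
    proof (intro prod.cong refl)
      fix i
      have "X i -` {0} \<inter> space M = space M - {\<omega> \<in> space M. X i \<omega> \<noteq> 0}" by auto
      then show "prob (X i -` {0} \<inter> space M) = 1 - p i"
        unfolding p_def by (simp add: prob_compl)
    qed
    also have "\<dots> \<le> (\<Prod>i\<in>{n..n + k}. exp (- p i))"
    proof (intro prod_mono conjI)
      show "0 \<le> 1 - p i" for i unfolding p_def by simp
      show "1 - p i \<le> exp (- p i)" for i using exp_ge_add_one_self[of "- p i"] by simp
    qed
    also have "\<dots> = exp (- (\<Sum>i\<in>{n..n + k}. p i))" by (simp add: exp_sum sum_negf[symmetric])
    also have "(\<Sum>i\<in>{n..n + k}. p i) = (\<Sum>i\<le>k. p (i + n))"
      using sum.shift_bounds_cl_nat_ivl[of p 0 n k] by (simp add: atLeast0AtMost add.commute)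
    finally have "ln (prob B) \<le> ln (exp (- (\<Sum>i\<le>k. p (i + n))))"
      using q by (subst ln_le_cancel_iff) auto
    then show ?thesis by simp
  qed
  have "summable (\<lambda>i. p (i + n))"
    by (rule bounded_imp_summable[OF _ bound]) (simp add: p_def)
  then show ?thesis unfolding p_def[symmetric] by (simp add: summable_iff_shift)
qed

section \<open>The competing growth process\<close>

text \<open>Early terms are set to zero instead of moving the first index, so that agents with
  different initial values can be subtracted term by term.\<close>

lemma reach_eq_sum:
  "reach x m k = (\<Sum>i<k. if m < Suc i then x (Suc i) else 0)"
  by (induction k) (auto simp: reach_def)

lemma seq_rv_apply [simp]: "j \<ge> 1 \<Longrightarrow> seq_rv Y \<omega> j = Y j \<omega>"
  by (simp add: seq_rv_def)

lemma reach_seq_rv [simp]: "reach (seq_rv Y \<omega>) m k = reach (\<lambda>j. Y j \<omega>) m k"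
  unfolding reach_def by (intro sum.cong) auto

lemma reach_measurable_seq [measurable]: "(\<lambda>f. reach f m k) \<in> borel_measurable seq_space"
  unfolding reach_def by (intro borel_measurable_sum measurable_component_singleton) auto

lemma component_Suc_measurable [measurable]: "(\<lambda>f. f (Suc i)) \<in> borel_measurable seq_space"
  by (intro measurable_component_singleton) auto

lemma (in prob_space) occurs_with_prob_1_iff:
  assumes "{\<omega> \<in> space M. P \<omega>} \<in> sets M"
  shows "occurs_with_prob M P 1 \<longleftrightarrow> (AE \<omega> in M. P \<omega>)"
  using assms by (simp add: occurs_with_prob_def prob_Collect_eq_1)

lemma (in prob_space) occurs_with_prob_0_iff:
  assumes "{\<omega> \<in> space M. P \<omega>} \<in> sets M"
  shows "occurs_with_prob M P 0 \<longleftrightarrow> (AE \<omega> in M. \<not> P \<omega>)"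
  using assms by (simp add: occurs_with_prob_def prob_Collect_eq_0)

lemma AE_pair_law_iff:
  assumes "distr N (S \<Otimes>\<^sub>M S) (\<lambda>\<omega>. (F \<omega>, G \<omega>)) = distr M (S \<Otimes>\<^sub>M S) (\<lambda>\<omega>. (F' \<omega>, G' \<omega>))"
    and [measurable]: "F \<in> measurable N S" "G \<in> measurable N S"
      "F' \<in> measurable M S" "G' \<in> measurable M S"
    and [measurable]: "Measurable.pred (S \<Otimes>\<^sub>M S) P"
  shows "(AE \<omega> in N. P (F \<omega>, G \<omega>)) \<longleftrightarrow> (AE \<omega> in M. P (F' \<omega>, G' \<omega>))"
proof -
  have "(AE \<omega> in N. P (F \<omega>, G \<omega>)) \<longleftrightarrow> (AE p in distr N (S \<Otimes>\<^sub>M S) (\<lambda>\<omega>. (F \<omega>, G \<omega>)). P p)"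
    by (subst AE_distr_iff) auto
  also have "\<dots> \<longleftrightarrow> (AE p in distr M (S \<Otimes>\<^sub>M S) (\<lambda>\<omega>. (F' \<omega>, G' \<omega>)). P p)"
    by (simp only: assms(1))
  also have "\<dots> \<longleftrightarrow> (AE \<omega> in M. P (F' \<omega>, G' \<omega>))"
    by (subst AE_distr_iff) auto
  finally show ?thesis .
qed

lemma emeasure_pair_law_eq:
  assumes "distr N (S \<Otimes>\<^sub>M S) (\<lambda>\<omega>. (F \<omega>, G \<omega>)) = distr M (S \<Otimes>\<^sub>M S) (\<lambda>\<omega>. (F' \<omega>, G' \<omega>))"
    and [measurable]: "F \<in> measurable N S" "G \<in> measurable N S"
      "F' \<in> measurable M S" "G' \<in> measurable M S"
    and P [measurable]: "Measurable.pred (S \<Otimes>\<^sub>M S) P"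
  shows "emeasure N {\<omega> \<in> space N. P (F \<omega>, G \<omega>)} = emeasure M {\<omega> \<in> space M. P (F' \<omega>, G' \<omega>)}"
proof -
  define D where "D = {p \<in> space (S \<Otimes>\<^sub>M S). P p}"
  have D: "D \<in> sets (S \<Otimes>\<^sub>M S)" unfolding D_def by measurable
  have "emeasure N {\<omega> \<in> space N. P (F \<omega>, G \<omega>)} = emeasure (distr N (S \<Otimes>\<^sub>M S) (\<lambda>\<omega>. (F \<omega>, G \<omega>))) D"
    using measurable_space[OF assms(2)] measurable_space[OF assms(3)]
    by (subst emeasure_distr[OF _ D])
      (auto simp: D_def space_pair_measure intro!: arg_cong[where f = "emeasure N"])
  also have "\<dots> = emeasure (distr M (S \<Otimes>\<^sub>M S) (\<lambda>\<omega>. (F' \<omega>, G' \<omega>))) D"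
    by (simp only: assms(1))
  also have "\<dots> = emeasure M {\<omega> \<in> space M. P (F' \<omega>, G' \<omega>)}"
    using measurable_space[OF assms(4)] measurable_space[OF assms(5)]
    by (subst emeasure_distr[OF _ D])
      (auto simp: D_def space_pair_measure intro!: arg_cong[where f = "emeasure M"])
  finally show ?thesis .
qed

lemma bdd_below_if_eventually_ge:
  fixes f g :: "nat \<Rightarrow> real"
  assumes "eventually (\<lambda>k. 0 \<le> f k) sequentially" and "\<And>k. f k - d \<le> g k"
  shows "\<exists>c. \<forall>k. c \<le> g k"
proof -
  obtain K where K: "\<And>k. k \<ge> K \<Longrightarrow> 0 \<le> f k" using assms(1) unfolding eventually_sequentially by blast
  define c where "c = Min (insert (- d) (g ` {..K}))"
  have "c \<le> g k" for k
  proof (cases "k \<le> K")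
    case True
    then show ?thesis unfolding c_def by (intro Min_le) auto
  next
    case False
    have "c \<le> - d" unfolding c_def by (intro Min_le) auto
    then show ?thesis using K[of k] assms(2)[of k] False by linarith
  qed
  then show ?thesis by blast
qed

text \<open>A nonzero limit fixes the sign of the late partial sums. If the limit is 0, the second
  hypothesis makes the partial sums eventually constant, hence equal to 0.\<close>

lemma eventually_sum_sign:
  fixes f :: "nat \<Rightarrow> real"
  assumes "summable f" and "f sums 0 \<longrightarrow> eventually (\<lambda>i. f i = 0) sequentially"
  shows "eventually (\<lambda>k. 0 \<le> (\<Sum>i<k. f i)) sequentially \<or> eventually (\<lambda>k. (\<Sum>i<k. f i) \<le> 0) sequentially"
proof -
  have lim: "(\<lambda>k. \<Sum>i<k. f i) \<longlonglongrightarrow> suminf f" using assms(1) by (rule summable_LIMSEQ)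
  consider "suminf f < 0" | "suminf f > 0" | "suminf f = 0" by linarith
  then show ?thesis
  proof cases
    case 1
    from order_tendstoD(2)[OF lim this] have "eventually (\<lambda>k. (\<Sum>i<k. f i) \<le> 0) sequentially"
      by (rule eventually_mono) simp
    then show ?thesis by blast
  next
    case 2
    from order_tendstoD(1)[OF lim this] have "eventually (\<lambda>k. 0 \<le> (\<Sum>i<k. f i)) sequentially"
      by (rule eventually_mono) simp
    then show ?thesis by blast
  next
    case 3
    then have "f sums 0" using assms(1) by (simp add: sums_iff)
    then obtain K where K: "\<And>i. i \<ge> K \<Longrightarrow> f i = 0"
      using assms(2) unfolding eventually_sequentially by blast
    then have "f sums (\<Sum>i<k. f i)" if "k \<ge> K" for k
      using that by (intro sums_finite) auto
    then have "(\<Sum>i<k. f i) = 0" if "k \<ge> K" for k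
      using that \<open>f sums 0\<close> sums_unique2 by blast
    then show ?thesis unfolding eventually_sequentially by (metis order_refl)
  qed
qed

context competing_growth_process
begin

section \<open>Measurability of the three events\<close>

abbreviation path :: "'w \<Rightarrow> nat \<Rightarrow> nat \<Rightarrow> real" where
  "path \<omega> \<equiv> \<lambda>a j. X a j \<omega>"

abbreviation reach_time :: "nat \<Rightarrow> nat \<Rightarrow> 'w \<Rightarrow> real" where
  "reach_time a k \<omega> \<equiv> reach (\<lambda>j. X a j \<omega>) (m a) k"

lemma X_measurable: "a \<in> {1..A} \<Longrightarrow> j \<ge> 1 \<Longrightarrow> X a j \<in> borel_measurable M"
  using indep by (auto simp: indep_vars_def)

lemma X_Suc_measurable [measurable]: "a \<in> {1..A} \<Longrightarrow> X a (Suc i) \<in> borel_measurable M"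
  by (intro X_measurable) auto

lemma waiting_times_path: "\<omega> \<in> space M \<Longrightarrow> waiting_times A (path \<omega>)"
  using two_agents nonneg by unfold_locales auto

lemma reach_time_measurable: "a \<in> {1..A} \<Longrightarrow> reach_time a k \<in> borel_measurable M"
  unfolding reach_def by (intro borel_measurable_sum X_measurable) auto

lemma tau_measurable [measurable]: "(\<lambda>\<omega>. tau A m (path \<omega>) n) \<in> borel_measurable M"
proof -
  have "(\<lambda>\<omega>. Min ((\<lambda>k. Max ((\<lambda>a. reach_time a (k a) \<omega>) ` {1..A})) ` profiles A n)) \<in> borel_measurable M"
    by (intro borel_measurable_Min borel_measurable_Max finite_profiles reach_time_measurable) auto
  then show ?thesis
    using waiting_times.tau_eq_Min[OF waiting_times_path] by (simp cong: measurable_cong)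
qed

text \<open>
  Totalised, because the measurability rules for bounded quantifiers over the agents do not hand
  on the bound.
\<close>

definition guarded_reach_time :: "nat \<Rightarrow> nat \<Rightarrow> 'w \<Rightarrow> real" where
  "guarded_reach_time a k \<omega> = (if a \<in> {1..A} then reach_time a k \<omega> else 0)"

lemma guarded_reach_time_measurable [measurable]: "guarded_reach_time a k \<in> borel_measurable M"
  unfolding guarded_reach_time_def using reach_time_measurable by (cases "a \<in> {1..A}") auto

text \<open>The order of two extended values at \<open>tau n\<close>, resolved into countably many
  comparisons of real random variables so as to be visibly measurable.\<close>

definition growth_le :: "nat \<Rightarrow> nat \<Rightarrow> nat \<Rightarrow> 'w \<Rightarrow> bool" where
  "growth_le b a n \<omega> \<longleftrightarrow> (\<forall>k. guarded_reach_time b k \<omega> \<le> tau A m (path \<omega>) n \<longrightarrow>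
      guarded_reach_time a k \<omega> \<le> tau A m (path \<omega>) n)"

lemma growth_le_measurable [measurable]: "Measurable.pred M (growth_le b a n)"
  unfolding growth_le_def by measurable

lemma growth_le_iff:
  assumes "\<omega> \<in> space M" "a \<in> {1..A}" "b \<in> {1..A}"
  shows "growth_le b a n \<omega> \<longleftrightarrow> growth A m (path \<omega>) b n \<le> growth A m (path \<omega>) a n"
  using assms waiting_times.le_growth_iff[OF waiting_times_path[OF assms(1)]]
  unfolding enat_le_iff[of "growth A m (path \<omega>) b n"] growth_le_def guarded_reach_time_def by simp

lemma leadership_measurable: "{\<omega> \<in> space M. leadership A m (path \<omega>)} \<in> sets M"
proof -
  have "{\<omega> \<in> space M. leadership A m (path \<omega>)} =
      {\<omega> \<in> space M. \<exists>a\<in>{1..A}. \<exists>n0. \<forall>n\<ge>n0. \<forall>b\<in>{1..A}. growth_le b a n \<omega>}"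
  proof (intro Collect_cong conj_cong refl)
    fix \<omega> assume \<omega>: "\<omega> \<in> space M"
    then show "leadership A m (path \<omega>) \<longleftrightarrow>
        (\<exists>a\<in>{1..A}. \<exists>n0. \<forall>n\<ge>n0. \<forall>b\<in>{1..A}. growth_le b a n \<omega>)"
      unfolding waiting_times.leadership_iff[OF waiting_times_path[OF \<omega>]] eventually_sequentially
      by (intro bex_cong ball_cong arg_cong[where f = Ex] arg_cong[where f = All] ext imp_cong refl)
        (simp add: growth_le_iff del: One_nat_def)
  qed
  also have "\<dots> \<in> sets M" by measurable
  finally show ?thesis .
qed

lemma strict_leadership_measurable: "{\<omega> \<in> space M. strict_leadership A m (path \<omega>)} \<in> sets M"
proof -
  have "{\<omega> \<in> space M. strict_leadership A m (path \<omega>)} =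
      {\<omega> \<in> space M. \<exists>a\<in>{1..A}. \<exists>n0. \<forall>n\<ge>n0. \<forall>b\<in>{1..A}. b \<noteq> a \<longrightarrow> \<not> growth_le a b n \<omega>}"
  proof (intro Collect_cong conj_cong refl)
    fix \<omega> assume "\<omega> \<in> space M"
    then show "strict_leadership A m (path \<omega>) \<longleftrightarrow>
        (\<exists>a\<in>{1..A}. \<exists>n0. \<forall>n\<ge>n0. \<forall>b\<in>{1..A}. b \<noteq> a \<longrightarrow> \<not> growth_le a b n \<omega>)"
      unfolding strict_leadership_def eventually_sequentially
      by (intro bex_cong ball_cong arg_cong[where f = Ex] arg_cong[where f = All] ext imp_cong refl)
        (simp add: growth_le_iff not_le del: One_nat_def)
  qed
  also have "\<dots> \<in> sets M" by measurable
  finally show ?thesis .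
qed

lemma monopoly_measurable: "{\<omega> \<in> space M. monopoly A m (path \<omega>)} \<in> sets M"
proof -
  define T where "T a \<omega> \<longleftrightarrow> (\<forall>k. \<exists>n. guarded_reach_time a k \<omega> \<le> tau A m (path \<omega>) n)" for a \<omega>
  have [measurable]: "Measurable.pred M (T a)" for a unfolding T_def by measurable
  have T: "T a \<omega> \<longleftrightarrow> growth A m (path \<omega>) a \<longlonglongrightarrow> \<infinity>" if "\<omega> \<in> space M" "a \<in> {1..A}" for a \<omega>
    using that waiting_times.growth_tendsto_infinity_iff[OF waiting_times_path]
    by (simp add: T_def guarded_reach_time_def)
  have "{\<omega> \<in> space M. monopoly A m (path \<omega>)} =
      {\<omega> \<in> space M. \<exists>a\<in>{1..A}. T a \<omega> \<and> (\<forall>b\<in>{1..A}. T b \<omega> \<longrightarrow> b = a)}"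
    unfolding monopoly_def Ex1_def using T by blast
  also have "\<dots> \<in> sets M" by measurable
  finally show ?thesis .
qed

section \<open>Independence and exchangeability of the agents\<close>

lemma seq_rv_measurable: "a \<in> {1..A} \<Longrightarrow> seq_rv (X a) \<in> measurable M seq_space"
  unfolding seq_rv_def by (intro measurable_restrict X_measurable) auto

lemma indep_seq_rv:
  assumes "a \<in> {1..A}" "b \<in> {1..A}" "a \<noteq> b"
  shows "indep_var seq_space (seq_rv (X a)) seq_space (seq_rv (X b))"
proof -
  have ind: "indep_var (Pi\<^sub>M ({a} \<times> {1..}) (\<lambda>_. borel)) (\<lambda>\<omega>. \<lambda>i\<in>{a} \<times> {1..}. (case i of (a, j) \<Rightarrow> X a j) \<omega>)
      (Pi\<^sub>M ({b} \<times> {1..}) (\<lambda>_. borel)) (\<lambda>\<omega>. \<lambda>i\<in>{b} \<times> {1..}. (case i of (a, j) \<Rightarrow> X a j) \<omega>)"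
    using assms by (intro indep_var_restrict[OF indep]) auto
  have meas: "(\<lambda>f. \<lambda>j\<in>{1..}. f (c, j)) \<in> measurable (Pi\<^sub>M ({c} \<times> {1..}) (\<lambda>_. borel)) seq_space" for c :: nat
    by (intro measurable_restrict measurable_component_singleton) auto
  have "(\<lambda>f. \<lambda>j\<in>{1..}. f (c, j)) \<circ> (\<lambda>\<omega>. \<lambda>i\<in>{c} \<times> {1..}. (case i of (a, j) \<Rightarrow> X a j) \<omega>) = seq_rv (X c)" for c
    by (auto simp: fun_eq_iff seq_rv_def)
  then show ?thesis using indep_var_compose[OF ind meas meas] by simp
qed

text \<open>The right-hand side does not mention \<open>a\<close> and \<open>b\<close>. This gives
  both the symmetry under exchanging two agents and the comparison of any two agents with two
  independent copies.\<close>

lemma pair_law: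
  assumes "a \<in> {1..A}" "b \<in> {1..A}" "a \<noteq> b"
  shows "distr M (seq_space \<Otimes>\<^sub>M seq_space) (\<lambda>\<omega>. (seq_rv (X a) \<omega>, seq_rv (X b) \<omega>)) =
    distr M seq_space (seq_rv (X 1)) \<Otimes>\<^sub>M distr M seq_space (seq_rv (X 1))"
  using indep_seq_rv[OF assms] same_law[OF assms(1)] same_law[OF assms(2)]
  by (simp add: indep_var_distribution_eq)

lemma distr_swap:
  assumes ab: "a \<in> {1..A}" "b \<in> {1..A}" "a \<noteq> b"
    and g: "g \<in> borel_measurable (seq_space \<Otimes>\<^sub>M seq_space)"
  shows "distr M borel (\<lambda>\<omega>. g (seq_rv (X a) \<omega>, seq_rv (X b) \<omega>)) =
    distr M borel (\<lambda>\<omega>. g (seq_rv (X b) \<omega>, seq_rv (X a) \<omega>))"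
proof -
  have *: "distr M borel (\<lambda>\<omega>. g (seq_rv (X a) \<omega>, seq_rv (X b) \<omega>)) =
      distr (distr M seq_space (seq_rv (X 1)) \<Otimes>\<^sub>M distr M seq_space (seq_rv (X 1))) borel g"
    if "a \<in> {1..A}" "b \<in> {1..A}" "a \<noteq> b" for a b
    unfolding pair_law[OF that, symmetric]
    using seq_rv_measurable[OF that(1)] seq_rv_measurable[OF that(2)] g
    by (subst distr_distr) (auto simp: comp_def)
  show ?thesis using *[OF ab] *[OF ab(2,1)] ab(3) by simp
qed

lemma AE_same_law:
  assumes ab: "a \<in> {1..A}" "b \<in> {1..A}" and [measurable]: "Measurable.pred seq_space P"
    and AE: "AE \<omega> in M. P (seq_rv (X a) \<omega>)"
  shows "AE \<omega> in M. P (seq_rv (X b) \<omega>)"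
proof -
  have "AE f in distr M seq_space (seq_rv (X a)). P f"
    using AE seq_rv_measurable[OF ab(1)] by (subst AE_distr_iff) (auto simp del: One_nat_def)
  moreover have "distr M seq_space (seq_rv (X a)) = distr M seq_space (seq_rv (X b))"
    using same_law[OF ab(1)] same_law[OF ab(2)] by simp
  ultimately have "AE f in distr M seq_space (seq_rv (X b)). P f" by (simp only:)
  then show ?thesis using seq_rv_measurable[OF ab(2)]
    by (subst (asm) AE_distr_iff) (auto simp del: One_nat_def)
qed

lemma indep_waiting_times:
  assumes "a \<in> {1..A}"
  shows "indep_vars (\<lambda>_. borel) (\<lambda>i. X a (Suc i)) UNIV"
proof -
  have "indep_vars (\<lambda>i. Pi\<^sub>M {(a, Suc i)} (\<lambda>_. borel))
      (\<lambda>i \<omega>. \<lambda>q\<in>{(a, Suc i)}. (case q of (a, j) \<Rightarrow> X a j) \<omega>) UNIV"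
    using assms by (intro indep_vars_restrict[OF indep]) (auto simp: disjoint_family_on_def)
  from indep_vars_compose2[OF this, of "\<lambda>i f. f (a, Suc i)" "\<lambda>_. borel"] show ?thesis by simp
qed

section \<open>Difference series of two agents\<close>

text \<open>Index \<open>i\<close> stands for the step to value \<open>Suc i\<close>; steps up to
  the initial value \<open>p\<close> contribute 0.\<close>

definition late :: "nat \<Rightarrow> nat \<Rightarrow> nat \<Rightarrow> 'w \<Rightarrow> real" where
  "late p a i \<omega> = (if p < Suc i then X a (Suc i) \<omega> else 0)"

text \<open>Nonnegative partial sums mean that \<open>a\<close> is no later than \<open>b\<close>.
  The initial values are parameters because both \<open>diff 0 0\<close>, all of whose terms are
  symmetric for distinct agents, and \<open>diff (m a) (m b)\<close>, whose partial sums compare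
  arrival times, occur; they differ in finitely many terms.\<close>

definition diff :: "nat \<Rightarrow> nat \<Rightarrow> nat \<Rightarrow> nat \<Rightarrow> nat \<Rightarrow> 'w \<Rightarrow> real" where
  "diff p q a b i \<omega> = late q b i \<omega> - late p a i \<omega>"

lemma late_measurable [measurable]: "a \<in> {1..A} \<Longrightarrow> late p a i \<in> borel_measurable M"
  unfolding late_def using X_Suc_measurable by (cases "p < Suc i") auto

lemma diff_measurable [measurable]:
  "a \<in> {1..A} \<Longrightarrow> b \<in> {1..A} \<Longrightarrow> diff p q a b i \<in> borel_measurable M"
  unfolding diff_def by measurable

lemma reach_time_eq_sum: "reach_time a k \<omega> = (\<Sum>i<k. late (m a) a i \<omega>)"
  unfolding reach_eq_sum late_def by simp

lemma reach_time_diff: "reach_time b k \<omega> - reach_time a k \<omega> = (\<Sum>i<k. diff (m a) (m b) a b i \<omega>)"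
  unfolding reach_time_eq_sum diff_def by (simp add: sum_subtractf)

lemma diff_eventually: "i \<ge> p \<Longrightarrow> i \<ge> q \<Longrightarrow> diff p q a b i \<omega> = diff 0 0 a b i \<omega>"
  unfolding diff_def late_def by simp

lemma summable_diff_iff: "summable (\<lambda>i. diff p q a b i \<omega>) \<longleftrightarrow> summable (\<lambda>i. diff 0 0 a b i \<omega>)"
  by (intro summable_cong) (auto simp: eventually_sequentially intro!: exI[of _ "max p q"] diff_eventually)

lemma indep_diff:
  assumes ab: "a \<in> {1..A}" "b \<in> {1..A}"
  shows "indep_vars (\<lambda>_. borel) (diff p q a b) UNIV"
proof -
  have "indep_vars (\<lambda>i. Pi\<^sub>M ({a, b} \<times> {Suc i}) (\<lambda>_. borel))
      (\<lambda>i \<omega>. \<lambda>r\<in>{a, b} \<times> {Suc i}. (case r of (a, j) \<Rightarrow> X a j) \<omega>) UNIV"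
    using ab by (intro indep_vars_restrict[OF indep]) (auto simp: disjoint_family_on_def)
  moreover have "(\<lambda>f. (if q < Suc i then f (b, Suc i) else 0) - (if p < Suc i then f (a, Suc i) else 0))
      \<in> borel_measurable (Pi\<^sub>M ({a, b} \<times> {Suc i}) (\<lambda>_. borel :: real measure))" for i
  proof -
    have "(\<lambda>f. if c then f r else 0) \<in> borel_measurable (Pi\<^sub>M ({a, b} \<times> {Suc i}) (\<lambda>_. borel :: real measure))"
      if "r \<in> {a, b} \<times> {Suc i}" for c and r :: "nat \<times> nat"
      using that by (cases c) auto
    then show ?thesis by (intro borel_measurable_diff) auto
  qed
  ultimately have "indep_vars (\<lambda>_. borel) (\<lambda>i \<omega>. (\<lambda>f. (if q < Suc i then f (b, Suc i) else 0) -
      (if p < Suc i then f (a, Suc i) else 0)) (\<lambda>r\<in>{a, b} \<times> {Suc i}. (case r of (a, j) \<Rightarrow> X a j) \<omega>)) UNIV"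
    by (rule indep_vars_compose2)
  then show ?thesis by (simp add: diff_def[abs_def] late_def cong: if_cong)
qed

lemma diff_symmetric:
  assumes ab: "a \<in> {1..A}" "b \<in> {1..A}" "a \<noteq> b" and i: "i \<ge> p" "i \<ge> q"
  shows "distr M borel (\<lambda>\<omega>. - diff p q a b i \<omega>) = distr M borel (diff p q a b i)"
proof -
  have "distr M borel (\<lambda>\<omega>. seq_rv (X b) \<omega> (Suc i) - seq_rv (X a) \<omega> (Suc i)) =
      distr M borel (\<lambda>\<omega>. seq_rv (X a) \<omega> (Suc i) - seq_rv (X b) \<omega> (Suc i))"
    using distr_swap[OF ab, of "\<lambda>p. snd p (Suc i) - fst p (Suc i)"] by simp
  then show ?thesis using i by (simp add: diff_def[abs_def] late_def)
qed

section \<open>Leadership and strict leadership\<close>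

text \<open>Finite values give some agent with positive waiting times beyond every level, possibly
  depending on the outcome. By the 0-1 law an agent has this property almost surely or almost never;
  the latter would pass to all agents by equality of laws and leave no candidate.\<close>

lemma AE_growing: "AE \<omega> in M. growing_waiting_times A m (path \<omega>)"
proof -
  define Q where "Q f \<longleftrightarrow> (\<forall>n. \<exists>i\<ge>n. 0 < f i)" for f :: "nat \<Rightarrow> real"
  have [measurable]: "Measurable.pred real_seq Q" unfolding Q_def by measurable
  have Q_seq [measurable]: "Measurable.pred seq_space (\<lambda>f. Q (\<lambda>i. f (Suc i)))"
    unfolding Q_def by measurable
  have tail: "Q (\<lambda>i. if i < N then 0 else f i) \<longleftrightarrow> Q f" for N f
  proof
    assume "Q f"
    show "Q (\<lambda>i. if i < N then 0 else f i)"
      unfolding Q_def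
    proof
      fix n
      obtain i where "i \<ge> max n N" "0 < f i" using \<open>Q f\<close> unfolding Q_def by blast
      then show "\<exists>i\<ge>n. 0 < (if i < N then 0 else f i)" by (intro exI[of _ i]) auto
    qed
  qed (auto simp: Q_def split: if_splits dest: spec intro: ccontr)
  have zo: "(AE \<omega> in M. Q (\<lambda>i. X a (Suc i) \<omega>)) \<or> (AE \<omega> in M. \<not> Q (\<lambda>i. X a (Suc i) \<omega>))"
    if "a \<in> {1..A}" for a
    using that by (intro zero_one_law_seq indep_waiting_times tail) measurable
  have finite: "AE \<omega> in M. finite_waiting_times A m (path \<omega>)"
    using finite_valued AE_space
    by eventually_elim
      (simp add: finite_waiting_times_def finite_waiting_times_axioms_def waiting_times_path)
  have some: "AE \<omega> in M. \<exists>a\<in>{1..A}. Q (\<lambda>i. X a (Suc i) \<omega>)"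
    using finite
  proof eventually_elim
    case (elim \<omega>)
    then obtain a where a: "a \<in> {1..A}" "\<And>k. \<exists>j>k. 0 < X a j \<omega>"
      using finite_waiting_times.ex_not_eventually_constant by blast
    have "Q (\<lambda>i. X a (Suc i) \<omega>)"
      unfolding Q_def
    proof
      fix n
      obtain j where "j > n" "0 < X a j \<omega>" using a by blast
      then show "\<exists>i\<ge>n. 0 < X a (Suc i) \<omega>" by (intro exI[of _ "j - 1"]) auto
    qed
    then show ?case using a by blast
  qed
  have all: "AE \<omega> in M. Q (\<lambda>i. X a (Suc i) \<omega>)" if a: "a \<in> {1..A}" for a
  proof (rule ccontr)
    assume "\<not> ?thesis"
    then have "AE \<omega> in M. \<not> Q (\<lambda>i. seq_rv (X a) \<omega> (Suc i))" using zo[OF a] by simp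
    then have "AE \<omega> in M. \<not> Q (\<lambda>i. seq_rv (X b) \<omega> (Suc i))" if "b \<in> {1..A}" for b
      by (rule AE_same_law[OF a that, rotated]) measurable
    then have "AE \<omega> in M. \<forall>b\<in>{1..A}. \<not> Q (\<lambda>i. X b (Suc i) \<omega>)"
      by (intro AE_finite_allI) auto
    with some have "AE \<omega> in M. False" by eventually_elim blast
    then show False by simp
  qed
  then have "AE \<omega> in M. \<forall>a\<in>{1..A}. Q (\<lambda>i. X a (Suc i) \<omega>)" by (intro AE_finite_allI) auto
  with finite show ?thesis
  proof eventually_elim
    case (elim \<omega>)
    have "\<exists>j>k. 0 < X a j \<omega>" if "a \<in> {1..A}" for a k
    proof -
      have "Q (\<lambda>i. X a (Suc i) \<omega>)" using elim that by blast
      then obtain i where "i \<ge> k" "0 < X a (Suc i) \<omega>" unfolding Q_def by blast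
      then show ?thesis by (intro exI[of _ "Suc i"]) auto
    qed
    then show ?case using elim
      by (simp add: growing_waiting_times_def growing_waiting_times_axioms_def)
  qed
qed

lemma AE_ex_ahead:
  assumes conv: "\<And>a b. a \<in> {1..A} \<Longrightarrow> b \<in> {1..A} \<Longrightarrow> a \<noteq> b \<Longrightarrow>
    AE \<omega> in M. summable (\<lambda>i. diff 0 0 a b i \<omega>)"
  shows "AE \<omega> in M. growing_waiting_times A m (path \<omega>) \<and>
    (\<exists>a\<in>{1..A}. \<forall>b\<in>{1..A}. eventually (\<lambda>k. reach_time a k \<omega> \<le> reach_time b k \<omega>) sequentially)"
proof -
  have "AE \<omega> in M. eventually (\<lambda>k. reach_time a k \<omega> \<le> reach_time b k \<omega>) sequentially \<or>
      eventually (\<lambda>k. reach_time b k \<omega> \<le> reach_time a k \<omega>) sequentially"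
    if ab: "a \<in> {1..A}" "b \<in> {1..A}" for a b
  proof (cases "a = b")
    case False
    have "AE \<omega> in M. (\<lambda>i. diff (m a) (m b) a b i \<omega>) sums 0 \<longrightarrow>
        eventually (\<lambda>i. diff (m a) (m b) a b i \<omega> = 0) sequentially"
      using ab False
      by (intro AE_symmetric_sums_zero[where N = "max (m a) (m b)"] indep_diff diff_symmetric) auto
    with conv[OF ab False] show ?thesis
    proof eventually_elim
      case (elim \<omega>)
      then show ?case
        using eventually_sum_sign[OF summable_diff_iff[THEN iffD2, OF elim(1)] elim(2)]
        unfolding reach_time_diff[symmetric] by simp
    qed
  qed simp
  then have "AE \<omega> in M. \<forall>a\<in>{1..A}. \<forall>b\<in>{1..A}.
      eventually (\<lambda>k. reach_time a k \<omega> \<le> reach_time b k \<omega>) sequentially \<or>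
      eventually (\<lambda>k. reach_time b k \<omega> \<le> reach_time a k \<omega>) sequentially"
    by (intro AE_finite_allI) auto
  with AE_growing show ?thesis
  proof eventually_elim
    case (elim \<omega>)
    then show ?case using growing_waiting_times.ex_ahead[of A m "path \<omega>"] by blast
  qed
qed

lemma AE_leadership:
  assumes "\<And>a b. a \<in> {1..A} \<Longrightarrow> b \<in> {1..A} \<Longrightarrow> a \<noteq> b \<Longrightarrow>
    AE \<omega> in M. summable (\<lambda>i. diff 0 0 a b i \<omega>)"
  shows "AE \<omega> in M. leadership A m (path \<omega>)"
proof -
  have "AE \<omega> in M. growing_waiting_times A m (path \<omega>) \<and>
    (\<exists>a\<in>{1..A}. \<forall>b\<in>{1..A}. eventually (\<lambda>k. reach_time a k \<omega> \<le> reach_time b k \<omega>) sequentially)"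
    by (rule AE_ex_ahead) (rule assms)
  then show ?thesis
  proof eventually_elim
    case (elim \<omega>)
    then obtain a where "a \<in> {1..A}"
        "\<And>b. b \<in> {1..A} \<Longrightarrow> eventually (\<lambda>k. reach_time a k \<omega> \<le> reach_time b k \<omega>) sequentially"
      by blast
    then show ?case
      using elim by (intro growing_waiting_times.leadership_if_ahead[of A m "path \<omega>" a]) blast+
  qed
qed

text \<open>The first Borel-Cantelli lemma is applied to every ordered pair of agents, as the leader
  depends on the outcome.\<close>

lemma AE_strict_leadership:
  assumes conv: "\<And>a b. a \<in> {1..A} \<Longrightarrow> b \<in> {1..A} \<Longrightarrow> a \<noteq> b \<Longrightarrow>
      AE \<omega> in M. summable (\<lambda>i. diff 0 0 a b i \<omega>)"
    and sum: "\<And>a b. a \<in> {1..A} \<Longrightarrow> b \<in> {1..A} \<Longrightarrow> a \<noteq> b \<Longrightarrow>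
      (\<Sum>i. emeasure M {\<omega> \<in> space M. 0 \<le> reach_time b (Suc i) \<omega> - reach_time a (Suc i) \<omega> \<and>
        reach_time b (Suc i) \<omega> - reach_time a (Suc i) \<omega> < X a (Suc i + 1) \<omega>}) < \<infinity>"
  shows "AE \<omega> in M. strict_leadership A m (path \<omega>)"
proof -
  define R where "R a b k \<omega> \<longleftrightarrow> 0 \<le> reach_time b k \<omega> - reach_time a k \<omega> \<and>
      reach_time b k \<omega> - reach_time a k \<omega> < X a (k + 1) \<omega>" for a b k \<omega>
  have ev: "AE \<omega> in M. eventually (\<lambda>k. \<not> R a b k \<omega>) sequentially"
    if ab: "a \<in> {1..A}" "b \<in> {1..A}" "a \<noteq> b" for a b
  proof -
    have [measurable]: "reach_time b k \<in> borel_measurable M" "reach_time a k \<in> borel_measurable M"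
        "X a (k + 1) \<in> borel_measurable M" for k
      using ab by (auto intro: reach_time_measurable X_measurable)
    have "AE \<omega> in M. eventually (\<lambda>i. \<omega> \<in> space M - {\<omega> \<in> space M. R a b (Suc i) \<omega>}) sequentially"
    proof (rule borel_cantelli_AE1)
      show "{\<omega> \<in> space M. R a b (Suc i) \<omega>} \<in> sets M" for i unfolding R_def by measurable
      show "emeasure M {\<omega> \<in> space M. R a b (Suc i) \<omega>} < \<infinity>" for i
        by (simp add: emeasure_eq_measure)
      have fin: "(\<Sum>i. emeasure M {\<omega> \<in> space M. R a b (Suc i) \<omega>}) < \<infinity>"
        using sum[OF ab] unfolding R_def .
      show "summable (\<lambda>i. measure M {\<omega> \<in> space M. R a b (Suc i) \<omega>})"
        using fin unfolding emeasure_eq_measure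
        by (intro summable_suminf_not_top) auto
    qed
    then show ?thesis
    proof eventually_elim
      case (elim \<omega>)
      then have "eventually (\<lambda>i. \<not> R a b (Suc i) \<omega>) sequentially" by (auto elim: eventually_mono)
      then show ?case by (subst (asm) eventually_sequentially_Suc)
    qed
  qed
  have "AE \<omega> in M. \<forall>a\<in>{1..A}. \<forall>b\<in>{1..A}. a \<noteq> b \<longrightarrow> eventually (\<lambda>k. \<not> R a b k \<omega>) sequentially"
    by (intro AE_finite_allI AE_impI) (auto intro: ev)
  moreover have "AE \<omega> in M. growing_waiting_times A m (path \<omega>) \<and>
    (\<exists>a\<in>{1..A}. \<forall>b\<in>{1..A}. eventually (\<lambda>k. reach_time a k \<omega> \<le> reach_time b k \<omega>) sequentially)"
    by (rule AE_ex_ahead) (rule conv)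
  ultimately show ?thesis
  proof eventually_elim
    case (elim \<omega>)
    then obtain a where a: "a \<in> {1..A}"
      and ahead: "\<And>b. b \<in> {1..A} \<Longrightarrow> eventually (\<lambda>k. reach_time a k \<omega> \<le> reach_time b k \<omega>) sequentially"
      by blast
    have "eventually (\<lambda>k. \<not> R a b k \<omega>) sequentially" if "b \<in> {1..A}" "b \<noteq> a" for b
      using elim(1) a that by auto
    then show ?case
      using elim(2) a ahead unfolding R_def
      by (intro growing_waiting_times.strict_leadership_if_ahead[of A m "path \<omega>" a]) simp_all
  qed
qed

section \<open>Absence of monopoly and of leadership\<close>

text \<open>The 0-1 law turns failure of almost sure convergence into almost sure divergence,
  equality of laws carries it to all agents, and a divergent series of nonnegative terms is
  unbounded.\<close>

lemma AE_unbounded: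
  assumes "\<not> (AE \<omega> in M. summable (\<lambda>i. X c (Suc i) \<omega>))" and c: "c \<in> {1..A}"
  shows "AE \<omega> in M. \<forall>a\<in>{1..A}. \<forall>t. \<exists>k. t < reach_time a k \<omega>"
proof (rule AE_finite_allI)
  fix a assume a: "a \<in> {1..A}"
  have "(AE \<omega> in M. summable (\<lambda>i. X c (Suc i) \<omega>)) \<or> (AE \<omega> in M. \<not> summable (\<lambda>i. X c (Suc i) \<omega>))"
    using c by (intro zero_one_law_seq indep_waiting_times summable_tail_iff) measurable
  then have "AE \<omega> in M. \<not> summable (\<lambda>i. seq_rv (X c) \<omega> (Suc i))" using assms by simp
  then have "AE \<omega> in M. \<not> summable (\<lambda>i. seq_rv (X a) \<omega> (Suc i))"
    by (rule AE_same_law[OF c a, rotated]) measurable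
  then show "AE \<omega> in M. \<forall>t. \<exists>k. t < reach_time a k \<omega>"
    using AE_space
  proof eventually_elim
    case (elim \<omega>)
    have "\<not> summable (\<lambda>i. late (m a) a i \<omega>)"
    proof
      assume "summable (\<lambda>i. late (m a) a i \<omega>)"
      moreover have "summable (\<lambda>i. late (m a) a i \<omega>) \<longleftrightarrow> summable (\<lambda>i. X a (Suc i) \<omega>)"
        by (intro summable_cong) (auto simp: eventually_sequentially late_def intro!: exI[of _ "m a"])
      ultimately show False using elim by simp
    qed
    moreover have "0 \<le> late (m a) a i \<omega>" for i using nonneg[OF a, of "Suc i"] elim by (simp add: late_def)
    ultimately have "\<exists>k. \<not> reach_time a k \<omega> \<le> t" for t
      unfolding reach_time_eq_sum using summableI_nonneg_bounded[of "\<lambda>i. late (m a) a i \<omega>" t] by metis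
    then show ?case by (simp add: not_le)
  qed
qed simp

lemma AE_not_monopoly:
  assumes "\<not> (AE \<omega> in M. summable (\<lambda>i. X c (Suc i) \<omega>))" and c: "c \<in> {1..A}"
  shows "AE \<omega> in M. \<not> monopoly A m (path \<omega>)"
  using AE_unbounded[OF assms] AE_space
proof eventually_elim
  case (elim \<omega>)
  then show ?case by (intro waiting_times.not_monopoly_if_unbounded[OF waiting_times_path]) blast+
qed

text \<open>If the waiting times of single agents had convergent sums, so would their differences;
  hence there is no explosion and a leader must be first at all late levels. That bounds the partial
  sums of a difference below, against their almost sure unboundedness.\<close>

lemma AE_not_leadership:
  assumes not_conv: "\<And>a b. a \<in> {1..A} \<Longrightarrow> b \<in> {1..A} \<Longrightarrow> a \<noteq> b \<Longrightarrow>
    \<not> (AE \<omega> in M. summable (\<lambda>i. diff 0 0 a b i \<omega>))"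
  shows "AE \<omega> in M. \<not> leadership A m (path \<omega>)"
proof -
  have agents: "1 \<in> {1..A}" "2 \<in> {1..A}" using two_agents by auto
  have "\<not> (AE \<omega> in M. summable (\<lambda>i. X 1 (Suc i) \<omega>))"
  proof
    assume 1: "AE \<omega> in M. summable (\<lambda>i. X 1 (Suc i) \<omega>)"
    then have "AE \<omega> in M. summable (\<lambda>i. seq_rv (X 1) \<omega> (Suc i))" by simp
    then have "AE \<omega> in M. summable (\<lambda>i. seq_rv (X 2) \<omega> (Suc i))"
      by (rule AE_same_law[OF agents, rotated]) measurable
    with 1 have "AE \<omega> in M. summable (\<lambda>i. diff 0 0 1 2 i \<omega>)"
      by eventually_elim (auto simp: diff_def late_def intro: summable_diff)
    then show False using not_conv[OF agents] by simp
  qed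
  then have unbounded: "AE \<omega> in M. \<forall>a\<in>{1..A}. \<forall>t. \<exists>k. t < reach_time a k \<omega>"
    using AE_unbounded agents by blast
  have "AE \<omega> in M. a \<noteq> b \<longrightarrow> \<not> eventually (\<lambda>k. reach_time a k \<omega> \<le> reach_time b k \<omega>) sequentially"
    if ab: "a \<in> {1..A}" "b \<in> {1..A}" for a b
  proof (cases "a = b")
    case False
    have "AE \<omega> in M. \<forall>c. \<exists>n. psum (\<lambda>i. diff 0 0 a b i \<omega>) n < c"
      using AE_symmetric_summable[OF indep_diff[OF ab] diff_symmetric[OF ab False], of 0 0]
        not_conv[OF ab False] by auto
    then show ?thesis
    proof eventually_elim
      case (elim \<omega>)
      show ?case
      proof (intro impI notI)
        assume "eventually (\<lambda>k. reach_time a k \<omega> \<le> reach_time b k \<omega>) sequentially"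
        then have ev: "eventually (\<lambda>k. 0 \<le> (\<Sum>i<k. diff (m a) (m b) a b i \<omega>)) sequentially"
          unfolding reach_time_diff[symmetric] by simp
        \<comment> \<open>Passing from the actual initial values to 0 changes only the terms before
          \<open>max (m a) (m b)\<close>; \<open>d\<close> bounds their effect on all partial
          sums.\<close>
        define d where "d = (\<Sum>i<max (m a) (m b). \<bar>diff (m a) (m b) a b i \<omega> - diff 0 0 a b i \<omega>\<bar>)"
        have "(\<Sum>i<k. diff (m a) (m b) a b i \<omega>) - d \<le> psum (\<lambda>i. diff 0 0 a b i \<omega>) k" for k
        proof -
          have "(\<Sum>i<k. diff (m a) (m b) a b i \<omega>) - psum (\<lambda>i. diff 0 0 a b i \<omega>) k \<le>
              (\<Sum>i<k. \<bar>diff (m a) (m b) a b i \<omega> - diff 0 0 a b i \<omega>\<bar>)"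
            unfolding psum_def sum_subtractf[symmetric] by (intro sum_mono) simp
          also have "\<dots> = (\<Sum>i\<in>{..<k} \<inter> {..<max (m a) (m b)}. \<bar>diff (m a) (m b) a b i \<omega> - diff 0 0 a b i \<omega>\<bar>)"
          proof (intro sum.mono_neutral_right ballI)
            fix i assume "i \<in> {..<k} - {..<k} \<inter> {..<max (m a) (m b)}"
            then show "\<bar>diff (m a) (m b) a b i \<omega> - diff 0 0 a b i \<omega>\<bar> = 0"
              by (subst diff_eventually) auto
          qed auto
          also have "\<dots> \<le> d" unfolding d_def by (intro sum_mono2) auto
          finally show ?thesis by simp
        qed
        from bdd_below_if_eventually_ge[OF ev this] show False using elim by (meson not_le)
      qed
    qed
  qed simp
  then have "AE \<omega> in M. \<forall>a\<in>{1..A}. \<forall>b\<in>{1..A}. a \<noteq> b \<longrightarrow>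
      \<not> eventually (\<lambda>k. reach_time a k \<omega> \<le> reach_time b k \<omega>) sequentially"
    by (intro AE_finite_allI) auto
  with unbounded show ?thesis
    using AE_space
  proof eventually_elim
    case (elim \<omega>)
    show ?case
    proof
      assume "leadership A m (path \<omega>)"
      from waiting_times.leadership_imp_ahead[OF waiting_times_path _ this] elim
      obtain a where a: "a \<in> {1..A}"
        "\<And>b. b \<in> {1..A} \<Longrightarrow> eventually (\<lambda>k. reach_time a k \<omega> \<le> reach_time b k \<omega>) sequentially"
        by blast
      obtain b where "b \<in> {1..A}" "b \<noteq> a"
      proof (cases "a = 1")
        case True
        then show ?thesis using agents(2) that[of 2] by simp
      next
        case False
        then show ?thesis using agents(1) that[of 1] by simp
      qed
      then have "\<not> eventually (\<lambda>k. reach_time a k \<omega> \<le> reach_time b k \<omega>) sequentially"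
        using elim(2) a(1) by auto
      then show False using a(2)[OF \<open>b \<in> {1..A}\<close>] by simp
    qed
  qed
qed

section \<open>Monopoly and the exclusion of ties\<close>

lemma AE_monopoly:
  assumes summable: "\<And>a. a \<in> {1..A} \<Longrightarrow> AE \<omega> in M. summable (\<lambda>i. late (m a) a i \<omega>)"
    and distinct: "\<And>a b. a \<in> {1..A} \<Longrightarrow> b \<in> {1..A} \<Longrightarrow> a \<noteq> b \<Longrightarrow>
      AE \<omega> in M. (\<Sum>i. late (m a) a i \<omega>) \<noteq> (\<Sum>i. late (m b) b i \<omega>)"
  shows "AE \<omega> in M. monopoly A m (path \<omega>)"
proof -
  have "AE \<omega> in M. \<forall>a\<in>{1..A}. summable (\<lambda>i. late (m a) a i \<omega>)"
    by (intro AE_finite_allI summable) auto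
  moreover have "AE \<omega> in M. \<forall>a\<in>{1..A}. \<forall>b\<in>{1..A}. a \<noteq> b \<longrightarrow>
      (\<Sum>i. late (m a) a i \<omega>) \<noteq> (\<Sum>i. late (m b) b i \<omega>)"
    by (intro AE_finite_allI AE_impI) (auto intro: distinct)
  ultimately show ?thesis
    using AE_growing
  proof eventually_elim
    case (elim \<omega>)
    have "(\<lambda>k. reach_time a k \<omega>) \<longlonglongrightarrow> (\<Sum>i. late (m a) a i \<omega>)" if "a \<in> {1..A}" for a
      unfolding reach_time_eq_sum using elim that by (intro summable_LIMSEQ) blast
    then show ?case
      using elim by (intro growing_waiting_times.monopoly_if_distinct) blast+
  qed
qed

text \<open>A tie would determine \<open>X a (Suc j)\<close> as a function \<open>V\<close> of all
  other waiting times, which are independent of it. The condition \<open>m a \<le> j\<close> ensures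
  that this waiting time enters the total of \<open>a\<close>.\<close>

lemma AE_distinct_if_no_atom:
  assumes ab: "a \<in> {1..A}" "b \<in> {1..A}" "a \<noteq> b"
    and summable: "\<And>a. a \<in> {1..A} \<Longrightarrow> AE \<omega> in M. summable (\<lambda>i. late (m a) a i \<omega>)"
    and j: "m a \<le> j" and no_atom: "\<And>x. measure (distr M borel (X a (Suc j))) {x} = 0"
  shows "AE \<omega> in M. (\<Sum>i. late (m a) a i \<omega>) \<noteq> (\<Sum>i. late (m b) b i \<omega>)"
proof -
  let ?I = "{1..A} \<times> {1..} :: (nat \<times> nat) set"
  define J where "J = ?I - {(a, Suc j)}"
  \<comment> \<open>The difference series of \<open>b\<close> and \<open>a\<close> without the
    contribution of \<open>X a (Suc j)\<close>.\<close>
  define h where "h f i = (if m b < Suc i then f (b, Suc i) else 0) -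
      (if m a < Suc i \<and> i \<noteq> j then f (a, Suc i) else 0)" for f :: "nat \<times> nat \<Rightarrow> real" and i
  define V where "V \<omega> = (\<Sum>i. h (\<lambda>(a, j). X a j \<omega>) i)" for \<omega>
  have h_meas: "(\<lambda>f. \<Sum>i. h f i) \<in> borel_measurable (Pi\<^sub>M J (\<lambda>_. borel))"
  proof (rule borel_measurable_suminf)
    fix i
    have "(\<lambda>f. if c then f r else 0) \<in> borel_measurable (Pi\<^sub>M J (\<lambda>_. borel :: real measure))"
      if "c \<Longrightarrow> r \<in> J" for c r
      using that by (cases c) (auto intro: measurable_component_singleton)
    then show "(\<lambda>f. h f i) \<in> borel_measurable (Pi\<^sub>M J (\<lambda>_. borel))"
      unfolding h_def using ab by (intro borel_measurable_diff) (auto simp: J_def)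
  qed
  have "indep_var borel ((\<lambda>f. \<Sum>i. h f i) \<circ> (\<lambda>\<omega>. \<lambda>r\<in>J. (case r of (a, j) \<Rightarrow> X a j) \<omega>))
      borel ((\<lambda>f. f (a, Suc j)) \<circ> (\<lambda>\<omega>. \<lambda>r\<in>{(a, Suc j)}. (case r of (a, j) \<Rightarrow> X a j) \<omega>))"
    using ab by (intro indep_var_compose[OF indep_var_restrict[OF indep]] h_meas) (auto simp: J_def)
  moreover have "(\<lambda>f. \<Sum>i. h f i) \<circ> (\<lambda>\<omega>. \<lambda>r\<in>J. (case r of (a, j) \<Rightarrow> X a j) \<omega>) = V"
    unfolding V_def h_def comp_def
    using ab by (intro ext arg_cong[where f = suminf]) (auto simp: J_def)
  moreover have "(\<lambda>f. f (a, Suc j)) \<circ> (\<lambda>\<omega>. \<lambda>r\<in>{(a, Suc j)}. (case r of (a, j) \<Rightarrow> X a j) \<omega>) = X a (Suc j)"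
    by auto
  ultimately have "indep_var borel V borel (X a (Suc j))" by simp
  then have "AE \<omega> in M. X a (Suc j) \<omega> \<noteq> V \<omega>" by (rule AE_indep_neq) (rule no_atom)
  with summable[OF ab(1)] summable[OF ab(2)] show ?thesis
  proof eventually_elim
    case (elim \<omega>)
    let ?s = "\<lambda>i. if i = j then X a (Suc i) \<omega> else 0"
    have "(\<lambda>i. late (m b) b i \<omega> - late (m a) a i \<omega> + ?s i) sums
        ((\<Sum>i. late (m b) b i \<omega>) - (\<Sum>i. late (m a) a i \<omega>) + X a (Suc j) \<omega>)"
      by (intro sums_add sums_diff summable_sums elim sums_single)
    moreover have "(\<lambda>i. late (m b) b i \<omega> - late (m a) a i \<omega> + ?s i) = h (\<lambda>(a, j). X a j \<omega>)"
      using j by (auto simp: fun_eq_iff h_def late_def)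
    \<comment> \<open>Putting the removed term back: if the totals agree, they cancel here and leave
      \<open>V \<omega> = X a (Suc j) \<omega>\<close>.\<close>
    ultimately have "V \<omega> = (\<Sum>i. late (m b) b i \<omega>) - (\<Sum>i. late (m a) a i \<omega>) + X a (Suc j) \<omega>"
      unfolding V_def by (simp add: sums_iff)
    then show ?case using elim by auto
  qed
qed

text \<open>A tie is a zero sum of the difference series, which almost surely forces the two agents
  to have equal waiting times from some level on. If that happened almost surely, the probabilities
  of unequal waiting times would be summable, hence also those of missing suitable constants
  \<open>c i\<close>, against \<open>spread\<close>; by the 0-1 law it almost surely does not
  happen.\<close>

lemma AE_distinct_if_not_concentrated:
  assumes ab: "a \<in> {1..A}" "b \<in> {1..A}" "a \<noteq> b"
    and summable: "\<And>a. a \<in> {1..A} \<Longrightarrow> AE \<omega> in M. summable (\<lambda>i. late (m a) a i \<omega>)"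
    and spread: "\<And>c :: nat \<Rightarrow> real. (\<And>i. 0 \<le> c i) \<Longrightarrow>
      (\<Sum>i. emeasure M {\<omega> \<in> space M. X b (Suc i) \<omega> \<noteq> c i}) = \<infinity>"
  shows "AE \<omega> in M. (\<Sum>i. late (m a) a i \<omega>) \<noteq> (\<Sum>i. late (m b) b i \<omega>)"
proof -
  note [measurable] = X_Suc_measurable[OF ab(1)] X_Suc_measurable[OF ab(2)]
  have tail: "eventually (\<lambda>i. (if i < N then 0 else f i) = 0) sequentially \<longleftrightarrow>
      eventually (\<lambda>i. f i = 0) sequentially" for N and f :: "nat \<Rightarrow> real"
    by (rule eventually_subst) (auto simp: eventually_sequentially intro: exI[of _ N])
  have pred: "Measurable.pred real_seq (\<lambda>f. eventually (\<lambda>i. f i = 0) sequentially)"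
    unfolding eventually_sequentially by measurable
  have "\<not> (AE \<omega> in M. eventually (\<lambda>i. diff 0 0 a b i \<omega> = 0) sequentially)"
  proof
    assume "AE \<omega> in M. eventually (\<lambda>i. diff 0 0 a b i \<omega> = 0) sequentially"
    from summable_prob_nonzero[OF indep_diff[OF ab(1,2)] this]
    moreover have "diff 0 0 a b i \<omega> \<noteq> 0 \<longleftrightarrow> X a (Suc i) \<omega> \<noteq> X b (Suc i) \<omega>" for i \<omega>
      by (auto simp: diff_def late_def)
    ultimately have sum: "summable (\<lambda>i. prob {\<omega> \<in> space M. X a (Suc i) \<omega> \<noteq> X b (Suc i) \<omega>})"
      by simp
    have "\<exists>c\<ge>0. emeasure M {\<omega> \<in> space M. X b (Suc i) \<omega> \<noteq> c} \<le>
        emeasure M {\<omega> \<in> space M. X a (Suc i) \<omega> \<noteq> X b (Suc i) \<omega>}" for i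
    proof (rule ex_dominant_value)
      have "indep_var borel ((\<lambda>f. f (Suc i)) \<circ> seq_rv (X a)) borel ((\<lambda>f. f (Suc i)) \<circ> seq_rv (X b))"
        by (intro indep_var_compose[OF indep_seq_rv[OF ab]] component_Suc_measurable)
      then show "indep_var borel (X a (Suc i)) borel (X b (Suc i))" by (simp add: comp_def)
      show "AE \<omega> in M. 0 \<le> X a (Suc i) \<omega>" using nonneg[OF ab(1)] by (intro AE_I2) simp
    qed
    then have "\<forall>i. \<exists>c\<ge>0. emeasure M {\<omega> \<in> space M. X b (Suc i) \<omega> \<noteq> c} \<le>
        emeasure M {\<omega> \<in> space M. X a (Suc i) \<omega> \<noteq> X b (Suc i) \<omega>}" by (rule allI)
    from choice[OF this] obtain c where c: "\<And>i. 0 \<le> c i"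
        "\<And>i. emeasure M {\<omega> \<in> space M. X b (Suc i) \<omega> \<noteq> c i} \<le>
          emeasure M {\<omega> \<in> space M. X a (Suc i) \<omega> \<noteq> X b (Suc i) \<omega>}" by blast
    have "(\<Sum>i. emeasure M {\<omega> \<in> space M. X b (Suc i) \<omega> \<noteq> c i}) \<le>
        (\<Sum>i. emeasure M {\<omega> \<in> space M. X a (Suc i) \<omega> \<noteq> X b (Suc i) \<omega>})"
      by (intro suminf_le c) auto
    also have "\<dots> < \<infinity>"
      using sum by (simp add: emeasure_eq_measure suminf_ennreal2)
    finally show False using spread[OF c(1)] by simp
  qed
  moreover have "(AE \<omega> in M. eventually (\<lambda>i. diff 0 0 a b i \<omega> = 0) sequentially) \<or>
      (AE \<omega> in M. \<not> eventually (\<lambda>i. diff 0 0 a b i \<omega> = 0) sequentially)"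
    using zero_one_law_seq[OF indep_diff[OF ab(1,2)] pred tail] by simp
  ultimately have "AE \<omega> in M. \<not> eventually (\<lambda>i. diff 0 0 a b i \<omega> = 0) sequentially" by blast
  moreover have "AE \<omega> in M. (\<lambda>i. diff (m a) (m b) a b i \<omega>) sums 0 \<longrightarrow>
      eventually (\<lambda>i. diff (m a) (m b) a b i \<omega> = 0) sequentially"
    using ab by (intro AE_symmetric_sums_zero[where N = "max (m a) (m b)"] indep_diff diff_symmetric) auto
  ultimately show ?thesis
    using summable[OF ab(1)] summable[OF ab(2)]
  proof eventually_elim
    case (elim \<omega>)
    show ?case
    proof
      assume eq: "(\<Sum>i. late (m a) a i \<omega>) = (\<Sum>i. late (m b) b i \<omega>)"
      have "(\<lambda>i. diff (m a) (m b) a b i \<omega>) sums ((\<Sum>i. late (m b) b i \<omega>) - (\<Sum>i. late (m a) a i \<omega>))"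
        unfolding diff_def by (intro sums_diff summable_sums elim)
      then have "eventually (\<lambda>i. diff (m a) (m b) a b i \<omega> = 0) sequentially" using elim eq by simp
      with eventually_ge_at_top[of "max (m a) (m b)"]
      have "eventually (\<lambda>i. diff 0 0 a b i \<omega> = 0) sequentially"
      proof eventually_elim
        case (elim i)
        then show ?case using diff_eventually[of "m a" i "m b" a b \<omega>] by simp
      qed
      then show False using elim by blast
    qed
  qed
qed

end

section \<open>Transfer to two independent copies of the waiting times\<close>

theorem theorem1p4:
  fixes M :: "'w measure" and N :: "'u measure"
    and A :: nat and m :: "nat \<Rightarrow> nat"
    and X :: "nat \<Rightarrow> nat \<Rightarrow> 'w \<Rightarrow> real"
    and Y Y' :: "nat \<Rightarrow> 'u \<Rightarrow> real"
  assumes process: "competing_growth_process M A m X"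
    and N: "prob_space N"
    and indep_YY': "prob_space.indep_var N seq_space (seq_rv Y) seq_space (seq_rv Y')"
    and law_Y: "distr N seq_space (seq_rv Y) = distr M seq_space (seq_rv (X 1))"
    and law_Y': "distr N seq_space (seq_rv Y') = distr M seq_space (seq_rv (X 1))"
  shows
    "(occurs_with_prob M (\<lambda>\<omega>. leadership A m (\<lambda>a j. X a j \<omega>)) 0 \<or>
      occurs_with_prob M (\<lambda>\<omega>. leadership A m (\<lambda>a j. X a j \<omega>)) 1)
     \<and>
     (occurs_with_prob M (\<lambda>\<omega>. leadership A m (\<lambda>a j. X a j \<omega>)) 1 \<longleftrightarrow>
      (AE \<omega> in N. summable (\<lambda>i. Y (Suc i) \<omega> - Y' (Suc i) \<omega>)))
     \<and>
     ((AE \<omega> in N. \<not> summable (\<lambda>i. Y (Suc i) \<omega>)) \<longrightarrow>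
      occurs_with_prob M (\<lambda>\<omega>. monopoly A m (\<lambda>a j. X a j \<omega>)) 0)
     \<and>
     ((AE \<omega> in N. summable (\<lambda>i. Y (Suc i) \<omega>)) \<and>
      ((\<forall>a\<in>{1..A}. \<forall>a'\<in>{1..A}. a \<noteq> a' \<longrightarrow>
          (\<exists>j > min (m a) (m a'). \<forall>x\<ge>0. measure (distr N borel (Y j)) {x} = 0))
       \<or>
       (\<forall>c :: nat \<Rightarrow> real. (\<forall>j\<ge>1. 0 \<le> c j) \<longrightarrow>
          (\<Sum>i. emeasure N {\<omega> \<in> space N. Y (Suc i) \<omega> \<noteq> c (Suc i)}) = \<infinity>)) \<longrightarrow>
      occurs_with_prob M (\<lambda>\<omega>. monopoly A m (\<lambda>a j. X a j \<omega>)) 1)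
     \<and>
     ((AE \<omega> in N. summable (\<lambda>i. Y (Suc i) \<omega> - Y' (Suc i) \<omega>)) \<and>
      (\<forall>a\<in>{1..A}. \<forall>a'\<in>{1..A}. a \<noteq> a' \<longrightarrow>
         (\<Sum>i. let k = Suc i in
            emeasure N {\<omega> \<in> space N.
              0 \<le> (\<Sum>j=m a'+1..k. Y' j \<omega>) - (\<Sum>j=m a+1..k. Y j \<omega>) \<and>
              (\<Sum>j=m a'+1..k. Y' j \<omega>) - (\<Sum>j=m a+1..k. Y j \<omega>) < Y (k + 1) \<omega>}) < \<infinity>) \<longrightarrow>
      occurs_with_prob M (\<lambda>\<omega>. strict_leadership A m (\<lambda>a j. X a j \<omega>)) 1)"
proof -
  interpret P: competing_growth_process M A m X by (rule process)
  interpret N: prob_space N by (rule N)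
  have Y [measurable]: "seq_rv Y \<in> measurable N seq_space" "seq_rv Y' \<in> measurable N seq_space"
    using indep_YY' by (auto dest: N.indep_var_rv1 N.indep_var_rv2)
  note Y_Suc [measurable] = measurable_compose[OF Y(1) component_Suc_measurable, simplified]
  have law: "distr N (seq_space \<Otimes>\<^sub>M seq_space) (\<lambda>\<omega>. (seq_rv Y \<omega>, seq_rv Y' \<omega>)) =
      distr M (seq_space \<Otimes>\<^sub>M seq_space) (\<lambda>\<omega>. (seq_rv (X a) \<omega>, seq_rv (X b) \<omega>))"
    if "a \<in> {1..A}" "b \<in> {1..A}" "a \<noteq> b" for a b
    using indep_YY' unfolding N.indep_var_distribution_eq P.pair_law[OF that] law_Y law_Y' by simp
  have AE_law: "(AE \<omega> in N. Q (seq_rv Y \<omega>, seq_rv Y' \<omega>)) \<longleftrightarrow>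
      (AE \<omega> in M. Q (seq_rv (X a) \<omega>, seq_rv (X b) \<omega>))"
    if "a \<in> {1..A}" "b \<in> {1..A}" "a \<noteq> b" and "Measurable.pred (seq_space \<Otimes>\<^sub>M seq_space) Q" for a b Q
    using that by (intro AE_pair_law_iff[OF law] Y P.seq_rv_measurable)
  have emeasure_law: "emeasure N {\<omega> \<in> space N. Q (seq_rv Y \<omega>, seq_rv Y' \<omega>)} =
      emeasure M {\<omega> \<in> space M. Q (seq_rv (X a) \<omega>, seq_rv (X b) \<omega>)}"
    if "a \<in> {1..A}" "b \<in> {1..A}" "a \<noteq> b" and "Measurable.pred (seq_space \<Otimes>\<^sub>M seq_space) Q" for a b Q
    using that by (intro emeasure_pair_law_eq[OF law] Y P.seq_rv_measurable)
  \<comment> \<open>Laws are compared for pairs of distinct agents, so a statement about one agent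
    also calls for a partner.\<close>
  have other: "\<exists>b\<in>{1..A}. a \<noteq> b" for a
    using P.two_agents by (intro bexI[of _ "if a = 1 then 2 else 1"]) auto
  define conv where "conv \<longleftrightarrow> (AE \<omega> in N. summable (\<lambda>i. Y (Suc i) \<omega> - Y' (Suc i) \<omega>))"
  \<comment> \<open>\<open>diff\<close> subtracts \<open>a\<close> from \<open>b\<close>, so here
    \<open>Y\<close> is matched with \<open>b\<close> and \<open>Y'\<close> with
    \<open>a\<close>.\<close>
  have conv: "conv \<longleftrightarrow> (AE \<omega> in M. summable (\<lambda>i. P.diff 0 0 a b i \<omega>))"
    if ab: "a \<in> {1..A}" "b \<in> {1..A}" "a \<noteq> b" for a b
    using AE_law[OF ab(2,1), of "\<lambda>p. summable (\<lambda>i. fst p (Suc i) - snd p (Suc i))"] ab(3)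
    by (simp add: conv_def P.diff_def P.late_def del: One_nat_def)
  have conv1: "(AE \<omega> in N. summable (\<lambda>i. Y (Suc i) \<omega>)) \<longleftrightarrow> (AE \<omega> in M. summable (\<lambda>i. X a (Suc i) \<omega>))"
    if a: "a \<in> {1..A}" for a
  proof -
    obtain b where "b \<in> {1..A}" "a \<noteq> b" using other by blast
    then show ?thesis
      using AE_law[OF a, of b "\<lambda>p. summable (\<lambda>i. fst p (Suc i))"] by (simp del: One_nat_def)
  qed
  have prob1: "emeasure N {\<omega> \<in> space N. Y (Suc i) \<omega> \<in> B} = emeasure M {\<omega> \<in> space M. X a (Suc i) \<omega> \<in> B}"
    if a: "a \<in> {1..A}" and [measurable]: "B \<in> sets borel" for a i B
  proof -
    obtain b where "b \<in> {1..A}" "a \<noteq> b" using other by blast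
    then show ?thesis
      using emeasure_law[OF a, of b "\<lambda>p. fst p (Suc i) \<in> B"] by (simp del: One_nat_def)
  qed
  note agents = P.two_agents
  have lead: "occurs_with_prob M (\<lambda>\<omega>. leadership A m (P.path \<omega>)) 1" if conv
    unfolding P.occurs_with_prob_1_iff[OF P.leadership_measurable]
    using that conv by (intro P.AE_leadership) blast
  have lead_not: "occurs_with_prob M (\<lambda>\<omega>. leadership A m (P.path \<omega>)) 0" if "\<not> conv"
    unfolding P.occurs_with_prob_0_iff[OF P.leadership_measurable]
    using that conv by (intro P.AE_not_leadership) blast
  have not_both: "\<not> (occurs_with_prob M Q 0 \<and> occurs_with_prob M Q 1)" for Q
    unfolding occurs_with_prob_def by simp
  have part1: "(occurs_with_prob M (\<lambda>\<omega>. leadership A m (P.path \<omega>)) 0 \<or>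
      occurs_with_prob M (\<lambda>\<omega>. leadership A m (P.path \<omega>)) 1) \<and>
      (occurs_with_prob M (\<lambda>\<omega>. leadership A m (P.path \<omega>)) 1 \<longleftrightarrow> conv)"
    using lead lead_not not_both by blast
  have part2: "occurs_with_prob M (\<lambda>\<omega>. monopoly A m (P.path \<omega>)) 0"
    if "AE \<omega> in N. \<not> summable (\<lambda>i. Y (Suc i) \<omega>)"
    unfolding P.occurs_with_prob_0_iff[OF P.monopoly_measurable]
  proof (rule P.AE_not_monopoly)
    show 1: "1 \<in> {1..A}" using agents by simp
    show "\<not> (AE \<omega> in M. summable (\<lambda>i. X 1 (Suc i) \<omega>))"
    proof
      assume "AE \<omega> in M. summable (\<lambda>i. X 1 (Suc i) \<omega>)"
      then have "AE \<omega> in N. summable (\<lambda>i. Y (Suc i) \<omega>)" using conv1[OF 1] by simp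
      with that have "AE \<omega> in N. False" by eventually_elim blast
      then show False by simp
    qed
  qed
  have part3: "occurs_with_prob M (\<lambda>\<omega>. monopoly A m (P.path \<omega>)) 1"
    if sum: "AE \<omega> in N. summable (\<lambda>i. Y (Suc i) \<omega>)"
      and hyp: "(\<forall>a\<in>{1..A}. \<forall>a'\<in>{1..A}. a \<noteq> a' \<longrightarrow>
          (\<exists>j > min (m a) (m a'). \<forall>x\<ge>0. measure (distr N borel (Y j)) {x} = 0))
       \<or>
       (\<forall>c :: nat \<Rightarrow> real. (\<forall>j\<ge>1. 0 \<le> c j) \<longrightarrow>
          (\<Sum>i. emeasure N {\<omega> \<in> space N. Y (Suc i) \<omega> \<noteq> c (Suc i)}) = \<infinity>)"
    unfolding P.occurs_with_prob_1_iff[OF P.monopoly_measurable]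
  proof (rule P.AE_monopoly)
    have summable: "AE \<omega> in M. summable (\<lambda>i. P.late (m a) a i \<omega>)" if a: "a \<in> {1..A}" for a
    proof -
      have "AE \<omega> in M. summable (\<lambda>i. X a (Suc i) \<omega>)" using conv1[OF a] sum by simp
      moreover have "summable (\<lambda>i. P.late (m a) a i \<omega>) \<longleftrightarrow> summable (\<lambda>i. X a (Suc i) \<omega>)" for \<omega>
        by (intro summable_cong) (auto simp: eventually_sequentially P.late_def intro!: exI[of _ "m a"])
      ultimately show ?thesis by simp
    qed
    then show "AE \<omega> in M. summable (\<lambda>i. P.late (m a) a i \<omega>)" if "a \<in> {1..A}" for a
      using that .
    fix a b assume ab: "a \<in> {1..A}" "b \<in> {1..A}" "a \<noteq> b"
    from hyp show "AE \<omega> in M. (\<Sum>i. P.late (m a) a i \<omega>) \<noteq> (\<Sum>i. P.late (m b) b i \<omega>)"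
    proof
      assume "\<forall>a\<in>{1..A}. \<forall>a'\<in>{1..A}. a \<noteq> a' \<longrightarrow>
          (\<exists>j > min (m a) (m a'). \<forall>x\<ge>0. measure (distr N borel (Y j)) {x} = 0)"
      then obtain j where j: "j > min (m a) (m b)"
          and no_atom: "\<And>x. 0 \<le> x \<Longrightarrow> measure (distr N borel (Y j)) {x} = 0"
        using ab by blast
      obtain i where i: "j = Suc i" using j by (cases j) auto
      have no_atom': "measure (distr M borel (X c (Suc i))) {x} = 0" if c: "c \<in> {1..A}" for c x
      proof (cases "0 \<le> x")
        case True
        have "measure (distr M borel (X c (Suc i))) {x} = measure M {\<omega> \<in> space M. X c (Suc i) \<omega> \<in> {x}}"
          using P.X_Suc_measurable[OF c]
          by (subst measure_distr) (auto intro!: arg_cong[where f = "measure M"])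
        also have "\<dots> = measure N {\<omega> \<in> space N. Y (Suc i) \<omega> \<in> {x}}"
          using prob1[OF c, of "{x}" i] unfolding measure_def by simp
        also have "\<dots> = measure (distr N borel (Y (Suc i))) {x}"
          using Y_Suc by (subst measure_distr) (auto intro!: arg_cong[where f = "measure N"])
        finally show ?thesis using no_atom[OF True] i by simp
      \<comment> \<open>Negative points carry no mass because waiting times are nonnegative.\<close>
      next
        case False
        then have "X c (Suc i) -` {x} \<inter> space M = {}" using P.nonneg[OF c, of "Suc i"] by auto
        then show ?thesis using P.X_Suc_measurable[OF c] by (subst measure_distr) auto
      qed
      \<comment> \<open>A level above the smaller initial value belongs to the total of at least one
        of the two agents; that agent provides the atomless summand.\<close>
      consider "m a \<le> i" | "m b \<le> i" using j i by linarith
      then show ?thesis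
      proof cases
        case 1
        show ?thesis by (rule P.AE_distinct_if_no_atom[OF ab summable 1 no_atom'[OF ab(1)]])
      next
        case 2
        have "b \<noteq> a" using ab by simp
        from P.AE_distinct_if_no_atom[OF ab(2,1) this summable 2 no_atom'[OF ab(2)]]
        show ?thesis by (simp add: eq_commute)
      qed
    next
      assume spread: "\<forall>c :: nat \<Rightarrow> real. (\<forall>j\<ge>1. 0 \<le> c j) \<longrightarrow>
          (\<Sum>i. emeasure N {\<omega> \<in> space N. Y (Suc i) \<omega> \<noteq> c (Suc i)}) = \<infinity>"
      show ?thesis
      proof (rule P.AE_distinct_if_not_concentrated[OF ab summable])
        fix c :: "nat \<Rightarrow> real" assume c: "\<And>i. 0 \<le> c i"
        \<comment> \<open>The hypothesis numbers the constants from 1 and the lemma from 0, whence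
          the shift by one.\<close>
        have "emeasure M {\<omega> \<in> space M. X b (Suc i) \<omega> \<noteq> c i} =
            emeasure N {\<omega> \<in> space N. Y (Suc i) \<omega> \<noteq> c (Suc i - 1)}" for i
          using prob1[OF ab(2), of "- {c i}" i] by simp
        moreover have "(\<Sum>i. emeasure N {\<omega> \<in> space N. Y (Suc i) \<omega> \<noteq> c (Suc i - 1)}) = \<infinity>"
          using spread[rule_format, of "\<lambda>j. c (j - 1)"] c by simp
        ultimately show "(\<Sum>i. emeasure M {\<omega> \<in> space M. X b (Suc i) \<omega> \<noteq> c i}) = \<infinity>"
          by simp
      qed
    qed
  qed
  have part4: "occurs_with_prob M (\<lambda>\<omega>. strict_leadership A m (P.path \<omega>)) 1"
    if conv and hyp: "\<forall>a\<in>{1..A}. \<forall>a'\<in>{1..A}. a \<noteq> a' \<longrightarrow>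
         (\<Sum>i. let k = Suc i in
            emeasure N {\<omega> \<in> space N.
              0 \<le> (\<Sum>j=m a'+1..k. Y' j \<omega>) - (\<Sum>j=m a+1..k. Y j \<omega>) \<and>
              (\<Sum>j=m a'+1..k. Y' j \<omega>) - (\<Sum>j=m a+1..k. Y j \<omega>) < Y (k + 1) \<omega>}) < \<infinity>"
    unfolding P.occurs_with_prob_1_iff[OF P.strict_leadership_measurable]
  proof (rule P.AE_strict_leadership)
    fix a b assume ab: "a \<in> {1..A}" "b \<in> {1..A}" "a \<noteq> b"
    show "AE \<omega> in M. summable (\<lambda>i. P.diff 0 0 a b i \<omega>)" using conv[OF ab] \<open>conv\<close> by simp
    \<comment> \<open>Here \<open>Y\<close> is matched with \<open>a\<close> and \<open>Y'\<close>
      with \<open>b\<close>, in the order of the hypothesis.\<close>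
    define Q where "Q k p \<longleftrightarrow> 0 \<le> reach (snd p) (m b) k - reach (fst p) (m a) k \<and>
        reach (snd p) (m b) k - reach (fst p) (m a) k < fst p (Suc k)"
      for k and p :: "(nat \<Rightarrow> real) \<times> (nat \<Rightarrow> real)"
    have "Measurable.pred (seq_space \<Otimes>\<^sub>M seq_space) (Q k)" for k unfolding Q_def by measurable
    from emeasure_law[OF ab this]
    have eq: "emeasure N {\<omega> \<in> space N. Q k (seq_rv Y \<omega>, seq_rv Y' \<omega>)} =
        emeasure M {\<omega> \<in> space M. Q k (seq_rv (X a) \<omega>, seq_rv (X b) \<omega>)}" for k .
    have "Q k (seq_rv Y \<omega>, seq_rv Y' \<omega>) \<longleftrightarrow>
        0 \<le> (\<Sum>j=m b+1..k. Y' j \<omega>) - (\<Sum>j=m a+1..k. Y j \<omega>) \<and>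
        (\<Sum>j=m b+1..k. Y' j \<omega>) - (\<Sum>j=m a+1..k. Y j \<omega>) < Y (k + 1) \<omega>" for k \<omega>
      unfolding Q_def fst_conv snd_conv reach_seq_rv unfolding reach_def by simp
    note Q_eq = this
    have "(\<Sum>i. emeasure N {\<omega> \<in> space N. Q (Suc i) (seq_rv Y \<omega>, seq_rv Y' \<omega>)}) < \<infinity>"
      unfolding Q_eq using hyp[rule_format, OF ab] unfolding Let_def .
    then show "(\<Sum>i. emeasure M {\<omega> \<in> space M.
        0 \<le> P.reach_time b (Suc i) \<omega> - P.reach_time a (Suc i) \<omega> \<and>
        P.reach_time b (Suc i) \<omega> - P.reach_time a (Suc i) \<omega> < X a (Suc i + 1) \<omega>}) < \<infinity>"
      unfolding eq unfolding Q_def by simp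
  qed
  show ?thesis
    unfolding conv_def[symmetric]
    by (intro conjI impI part1[THEN conjunct1] part1[THEN conjunct2];
      (erule part2 | (elim conjE, erule (1) part3) | (elim conjE, erule (1) part4)))
qed

end
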